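(* Call a germ $f:(\mathbb{R}^2,0)\to(\mathbb{R}^3,0)$ of normal form with data $(a,b,c)$ if $$f(u,v)=\big(u^2-v^2,\ a(u^2+v^2)+b(u,v),\ c(u,v)\big),$$ $b(u,v)=u^3b_1(u)+u^2v^2b_2(u,v)+v^3b_3(v)$, $c(u,v)=u^3c_1(u)+u^2v^2c_2(u,v)+v^3c_3(v)$, with $b_1,b_3,c_1,c_3$ smooth germs of one variable, $b_2,c_2$ smooth germs of two variables, and $a>0$, $c_1(0)>0$, $c_3(0)>0$. Let $f$ and $\hat f$ be of normal form with data $(a,b,c)$ and $(\hat a,\hat b,\hat c)$ respectively (all quantities with hats defined analogously). Let $s$ be a germ of an orientation-preserving diffeomorphism of $(\mathbb{R}^2,0)$ and $A\in SO(3)$. (i) If the $3$-jets at $0$ of $A\circ f\circ s^{-1}$ and of $\hat f$ coincide, then $a=\hat a$, $b_1(0)=\hat b_1(0)$, $b_3(0)=\hat b_3(0)$, $c_1(0)=\hat c_1(0)$ and $c_3(0)=\hat c_3(0)$; equivalently the $3$-jets of $f$ and $\hat f$ at $0$ coincide. (ii) If $A\circ f\circ s^{-1}=f$ as germs, then $A$ is the identity and, for every $r\ge1$, the $r$-jet of $s$ at $0$ equals the $r$-jet of the identity map. *)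

theory Defs
  imports "HOL-Analysis.Analysis"
begin

definition smooth_on :: "'a::euclidean_space set \<Rightarrow> ('a \<Rightarrow> 'b::real_normed_vector) \<Rightarrow> bool" where
  "smooth_on U f \<longleftrightarrow>
     (\<exists>F. f \<in> F \<and> (\<forall>g\<in>F. \<exists>g'. (\<forall>x\<in>U. (g has_derivative g' x) (at x))
                               \<and> (\<forall>i\<in>Basis. (\<lambda>x. g' x i) \<in> F)))"

fun iter_pd :: "'a::euclidean_space list \<Rightarrow> ('a \<Rightarrow> 'b::real_normed_vector) \<Rightarrow> 'a \<Rightarrow> 'b" where
  "iter_pd [] f = f"
| "iter_pd (i # is) f = iter_pd is (\<lambda>x. frechet_derivative f (at x) i)"

definition jet_eq :: "nat \<Rightarrow> ('a::euclidean_space \<Rightarrow> 'b::real_normed_vector) \<Rightarrow> ('a \<Rightarrow> 'b) \<Rightarrow> 'a \<Rightarrow> bool" where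
  "jet_eq r f g x0 \<longleftrightarrow>
     (\<forall>is. set is \<subseteq> Basis \<and> length is \<le> r \<longrightarrow> iter_pd is f x0 = iter_pd is g x0)"

definition nf_map :: "real \<Rightarrow> (real \<Rightarrow> real) \<Rightarrow> (real^2 \<Rightarrow> real) \<Rightarrow> (real \<Rightarrow> real)
    \<Rightarrow> (real \<Rightarrow> real) \<Rightarrow> (real^2 \<Rightarrow> real) \<Rightarrow> (real \<Rightarrow> real) \<Rightarrow> real^2 \<Rightarrow> real^3" where
  "nf_map a b1 b2 b3 c1 c2 c3 x =
     (let u = x$1; v = x$2 in
      vector [u^2 - v^2,
              a * (u^2 + v^2) + (u^3 * b1 u + u^2 * v^2 * b2 x + v^3 * b3 v),
              u^3 * c1 u + u^2 * v^2 * c2 x + v^3 * c3 v])"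

definition nf_data :: "real \<Rightarrow> (real \<Rightarrow> real) \<Rightarrow> (real^2 \<Rightarrow> real) \<Rightarrow> (real \<Rightarrow> real)
    \<Rightarrow> (real \<Rightarrow> real) \<Rightarrow> (real^2 \<Rightarrow> real) \<Rightarrow> (real \<Rightarrow> real) \<Rightarrow> bool" where
  "nf_data a b1 b2 b3 c1 c2 c3 \<longleftrightarrow>
     a > 0 \<and> c1 0 > 0 \<and> c3 0 > 0 \<and>
     (\<exists>W. open W \<and> 0 \<in> W \<and> smooth_on W b1 \<and> smooth_on W b3 \<and> smooth_on W c1 \<and> smooth_on W c3) \<and>
     (\<exists>W. open W \<and> (0::real^2) \<in> W \<and> smooth_on W b2 \<and> smooth_on W c2)"

text \<open>s is (a representative of) a germ of an orientation-preserving diffeomorphism of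
(R^2,0), with sinv (a representative of) its inverse germ.\<close>
definition or_diffeo_germ :: "(real^2 \<Rightarrow> real^2) \<Rightarrow> (real^2 \<Rightarrow> real^2) \<Rightarrow> bool" where
  "or_diffeo_germ s sinv \<longleftrightarrow>
     (\<exists>U V. open U \<and> open V \<and> 0 \<in> U \<and> s 0 = 0 \<and> s ` U = V \<and>
            smooth_on U s \<and> smooth_on V sinv \<and>
            (\<forall>x\<in>U. sinv (s x) = x) \<and> (\<forall>y\<in>V. s (sinv y) = y) \<and>
            det (jacobian s (at 0)) > 0)"

end

theory Submission
  imports Defs
begin

text \<open>Write \<open>t = s\<^sup>-\<^sup>1\<close> with linear part \<open>L\<close>. Comparing quadratic parts, \<open>A\<close> must preserve the
  plane spanned by the quadratic part of \<open>f\<close>, so it splits into an orthogonal \<open>2 \<times> 2\<close> block and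
  \<open>\<plusminus>1\<close>. The cubic part of the third coordinate then turns \<open>c\<^sub>1(0) U\<^sup>3 + c\<^sub>3(0) V\<^sup>3\<close> with
  \<open>(U, V) = L(u, v)\<close> into another sum of two cubes, which forces \<open>L\<close> to be diagonal or
  antidiagonal; positivity of the \<open>c\<^sub>j(0)\<close> and of \<open>det L\<close> excludes the second case, and the quadratic
  parts leave only \<open>A = 1\<close>, \<open>L = 1\<close>, \<open>a = a'\<close>. On the coordinate axes the off-axis coordinate
  of \<open>t\<close> is \<open>O(\<tau>\<^sup>2)\<close>, hence its square does not affect the 3-jet and the cubic parts of \<open>b\<close> and
  \<open>b'\<close> agree there.

  If \<open>f \<circ> s = f\<close> near 0, then \<open>s\<close> is exactly the identity on an open cone with vertex 0, where
  \<open>(U\<^sup>2, V\<^sup>2)\<close> determines \<open>(U, V)\<close> up to an error that is absorbed by the flatness of \<open>b\<close>.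
  All derivatives of \<open>s\<close> therefore agree with those of the identity on the cone, and by continuity
  at 0.\<close>

section \<open>Finite differentiability and jets\<close>

text \<open>A graded form of \<open>smooth_on\<close>, so that regularity proofs can run by
  induction on \<open>n\<close>. Only the partial derivatives along \<open>Basis\<close> are
  iterated: they have the same type as \<open>f\<close>, which keeps the recursion within one
  type.\<close>

fun Ck_on :: "nat \<Rightarrow> 'a::euclidean_space set \<Rightarrow> ('a \<Rightarrow> 'b::real_normed_vector) \<Rightarrow> bool" where
  "Ck_on 0 U f \<longleftrightarrow> continuous_on U f"
| "Ck_on (Suc n) U f \<longleftrightarrow>
     (\<exists>f'. (\<forall>x\<in>U. (f has_derivative f' x) (at x)) \<and> (\<forall>i\<in>Basis. Ck_on n U (\<lambda>x. f' x i)))"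

lemma Ck_onI:
  assumes "\<And>x. x \<in> U \<Longrightarrow> (f has_derivative f' x) (at x)"
    and "\<And>i. i \<in> Basis \<Longrightarrow> Ck_on n U (\<lambda>x. f' x i)"
  shows "Ck_on (Suc n) U f"
  unfolding Ck_on.simps by (intro exI[of _ f'] conjI ballI assms)

lemma Ck_onE:
  assumes "Ck_on (Suc n) U f"
  obtains f' where "\<And>x. x \<in> U \<Longrightarrow> (f has_derivative f' x) (at x)"
    and "\<And>i. i \<in> Basis \<Longrightarrow> Ck_on n U (\<lambda>x. f' x i)"
  using assms by (metis Ck_on.simps(2))

lemma Ck_on_cong:
  assumes "open U" "\<And>x. x \<in> U \<Longrightarrow> f x = g x" "Ck_on n U f"
  shows "Ck_on n U g"
proof (cases n)
  case 0
  then show ?thesis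
    using assms continuous_on_cong[of U U f g] by simp
next
  case (Suc m)
  obtain f' where f': "\<And>x. x \<in> U \<Longrightarrow> (f has_derivative f' x) (at x)"
    "\<And>i. i \<in> Basis \<Longrightarrow> Ck_on m U (\<lambda>x. f' x i)"
    using Ck_onE assms(3) Suc by metis
  have "(g has_derivative f' x) (at x)" if "x \<in> U" for x
    using has_derivative_transform_within_open[OF f'(1)[OF that] assms(1) that] assms(2) by blast
  then show ?thesis
    unfolding Suc using f'(2) by (intro Ck_onI) auto
qed

lemma Ck_on_subset: "Ck_on n U f \<Longrightarrow> V \<subseteq> U \<Longrightarrow> Ck_on n V f"
proof (induction n arbitrary: f)
  case 0
  then show ?case by (auto intro: continuous_on_subset)
next
  case (Suc n)
  obtain f' where f': "\<And>x. x \<in> U \<Longrightarrow> (f has_derivative f' x) (at x)"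
    "\<And>i. i \<in> Basis \<Longrightarrow> Ck_on n U (\<lambda>x. f' x i)"
    using Ck_onE[OF Suc.prems(1)] by blast
  show ?case
    using f' Suc by (intro Ck_onI) auto
qed

lemma continuous_on_if_has_derivative:
  assumes "\<And>x. x \<in> U \<Longrightarrow> (f has_derivative f' x) (at x)"
  shows "continuous_on U f"
  by (rule has_derivative_continuous_on) (rule has_derivative_at_withinI[OF assms])

lemma Ck_on_imp_continuous:
  assumes "Ck_on n U f"
  shows "continuous_on U f"
proof (cases n)
  case 0
  then show ?thesis using assms by simp
next
  case (Suc m)
  then show ?thesis
    using assms Ck_onE continuous_on_if_has_derivative by metis
qed

lemma Ck_on_Suc_imp: "Ck_on (Suc n) U f \<Longrightarrow> Ck_on n U f"
proof (induction n arbitrary: f)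
  case 0
  then show ?case using Ck_on_imp_continuous[OF 0] by simp
next
  case (Suc n)
  obtain f' where f': "\<And>x. x \<in> U \<Longrightarrow> (f has_derivative f' x) (at x)"
    "\<And>i. i \<in> Basis \<Longrightarrow> Ck_on (Suc n) U (\<lambda>x. f' x i)"
    using Ck_onE[OF Suc.prems] by blast
  show ?case
    using f' Suc.IH by (intro Ck_onI) auto
qed

text \<open>The family \<open>F\<close> witnessing smoothness is closed under partial derivatives,
  so the induction on \<open>n\<close> runs over all members of \<open>F\<close> at once.\<close>

lemma smooth_on_imp_Ck_on:
  assumes "smooth_on U f"
  shows "Ck_on n U f"
proof -
  obtain F where F: "f \<in> F" "\<And>g. g \<in> F \<Longrightarrow> \<exists>g'. (\<forall>x\<in>U. (g has_derivative g' x) (at x))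
      \<and> (\<forall>i\<in>Basis. (\<lambda>x. g' x i) \<in> F)"
    using assms unfolding smooth_on_def by blast
  have "Ck_on n U g" if "g \<in> F" for g
    using that
  proof (induction n arbitrary: g)
    case 0
    then show ?case
      using F(2)[OF 0] continuous_on_if_has_derivative[of U g] by auto
  next
    case (Suc n)
    obtain g' where "\<forall>x\<in>U. (g has_derivative g' x) (at x)" "\<forall>i\<in>Basis. (\<lambda>x. g' x i) \<in> F"
      using F(2)[OF Suc.prems] by blast
    then show ?case
      using Suc.IH by (intro Ck_onI[where f'=g']) auto
  qed
  then show ?thesis using F(1) by blast
qed

section \<open>Closure properties of finite differentiability\<close>

lemma Ck_on_const: "Ck_on n U (\<lambda>x. c)"
proof (induction n arbitrary: c)
  case (Suc n)
  show ?case
    by (rule Ck_onI[where f'="\<lambda>_ _. 0"]) (auto simp: Suc)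
qed simp

lemma Ck_on_linear: "bounded_linear f \<Longrightarrow> Ck_on n U f"
  by (cases n) (auto intro: bounded_linear_imp_has_derivative linear_continuous_on Ck_on_const)

lemma Ck_on_bounded_linear:
  assumes "bounded_linear l"
  shows "Ck_on n U f \<Longrightarrow> Ck_on n U (\<lambda>x. l (f x))"
proof (induction n arbitrary: f)
  case 0
  then show ?case using assms bounded_linear.continuous_on by auto
next
  case (Suc n)
  obtain f' where f': "\<And>x. x \<in> U \<Longrightarrow> (f has_derivative f' x) (at x)"
    "\<And>i. i \<in> Basis \<Longrightarrow> Ck_on n U (\<lambda>x. f' x i)"
    using Ck_onE[OF Suc.prems] by blast
  show ?case
    using f' Suc.IH assms
    by (intro Ck_onI[where f'="\<lambda>x h. l (f' x h)"]) (auto intro: bounded_linear.has_derivative)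
qed

lemma Ck_on_add: "Ck_on n U f \<Longrightarrow> Ck_on n U g \<Longrightarrow> Ck_on n U (\<lambda>x. f x + g x)"
proof (induction n arbitrary: f g)
  case 0
  then show ?case by (auto intro: continuous_intros)
next
  case (Suc n)
  obtain f' where f': "\<And>x. x \<in> U \<Longrightarrow> (f has_derivative f' x) (at x)"
    "\<And>i. i \<in> Basis \<Longrightarrow> Ck_on n U (\<lambda>x. f' x i)"
    using Ck_onE[OF Suc.prems(1)] by blast
  obtain g' where g': "\<And>x. x \<in> U \<Longrightarrow> (g has_derivative g' x) (at x)"
    "\<And>i. i \<in> Basis \<Longrightarrow> Ck_on n U (\<lambda>x. g' x i)"
    using Ck_onE[OF Suc.prems(2)] by blast
  show ?case
    using f' g' Suc.IH
    by (intro Ck_onI[where f'="\<lambda>x h. f' x h + g' x h"]) (auto intro: has_derivative_add)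
qed

lemma Ck_on_diff: "Ck_on n U f \<Longrightarrow> Ck_on n U g \<Longrightarrow> Ck_on n U (\<lambda>x. f x - g x)"
  using Ck_on_add[of n U f "\<lambda>x. - g x"]
    Ck_on_bounded_linear[OF bounded_linear_minus[OF bounded_linear_ident], of n U g]
  by (simp only: diff_conv_add_uminus)

lemma Ck_on_sum:
  assumes "finite I" "\<And>i. i \<in> I \<Longrightarrow> Ck_on n U (f i)"
  shows "Ck_on n U (\<lambda>x. \<Sum>i\<in>I. f i x)"
  using assms
proof (induction I)
  case empty
  show ?case by (simp add: Ck_on_const)
next
  case (insert i I)
  then show ?case using Ck_on_add[of n U "f i" "\<lambda>x. \<Sum>i\<in>I. f i x"] by simp
qed

lemma Ck_on_bilinear:
  assumes "bounded_bilinear mul"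
  shows "Ck_on n U f \<Longrightarrow> Ck_on n U g \<Longrightarrow> Ck_on n U (\<lambda>x. mul (f x) (g x))"
proof (induction n arbitrary: f g)
  case 0
  then show ?case using bounded_bilinear.continuous_on[OF assms] by auto
next
  case (Suc n)
  obtain f' where f': "\<And>x. x \<in> U \<Longrightarrow> (f has_derivative f' x) (at x)"
    "\<And>i. i \<in> Basis \<Longrightarrow> Ck_on n U (\<lambda>x. f' x i)"
    using Ck_onE[OF Suc.prems(1)] by blast
  obtain g' where g': "\<And>x. x \<in> U \<Longrightarrow> (g has_derivative g' x) (at x)"
    "\<And>i. i \<in> Basis \<Longrightarrow> Ck_on n U (\<lambda>x. g' x i)"
    using Ck_onE[OF Suc.prems(2)] by blast
  show ?case
  proof (rule Ck_onI[where f'="\<lambda>x h. mul (f x) (g' x h) + mul (f' x h) (g x)"])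
    show "((\<lambda>x. mul (f x) (g x)) has_derivative
        (\<lambda>h. mul (f x) (g' x h) + mul (f' x h) (g x))) (at x)" if "x \<in> U" for x
      using bounded_bilinear.FDERIV[OF assms f'(1)[OF that] g'(1)[OF that]] .
    show "Ck_on n U (\<lambda>x. mul (f x) (g' x i) + mul (f' x i) (g x))" if "i \<in> Basis" for i
      by (rule Ck_on_add[OF Suc.IH[OF Ck_on_Suc_imp[OF Suc.prems(1)] g'(2)[OF that]]
            Suc.IH[OF f'(2)[OF that] Ck_on_Suc_imp[OF Suc.prems(2)]]])
  qed
qed

lemmas Ck_on_mult = Ck_on_bilinear[OF bounded_bilinear_mult]
lemmas Ck_on_scaleR = Ck_on_bilinear[OF bounded_bilinear_scaleR]

lemma linear_Basis_expansion:
  fixes f :: "'a::euclidean_space \<Rightarrow> 'b::real_vector"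
  assumes "linear f"
  shows "f h = (\<Sum>j\<in>Basis. (h \<bullet> j) *\<^sub>R f j)"
proof -
  have "f h = f (\<Sum>j\<in>Basis. (h \<bullet> j) *\<^sub>R j)"
    by (rule arg_cong[OF euclidean_representation[symmetric]])
  also have "\<dots> = (\<Sum>j\<in>Basis. f ((h \<bullet> j) *\<^sub>R j))"
    by (rule linear_sum[OF assms])
  also have "\<dots> = (\<Sum>j\<in>Basis. (h \<bullet> j) *\<^sub>R f j)"
    by (intro sum.cong refl linear_scale[OF assms])
  finally show ?thesis .
qed

text \<open>The chain rule is expanded in the basis, so that each partial derivative of the
  composite is a sum of products of a component of \<open>t'\<close> with a partial derivative of
  \<open>g\<close> composed with \<open>t\<close>. The second factor is covered by the induction
  hypothesis, since \<open>t\<close> is also of class \<open>n\<close>.\<close>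

lemma Ck_on_compose:
  fixes g :: "'b::euclidean_space \<Rightarrow> 'c::real_normed_vector"
  assumes "t ` U \<subseteq> V"
  shows "Ck_on n V g \<Longrightarrow> Ck_on n U t \<Longrightarrow> Ck_on n U (\<lambda>x. g (t x))"
proof (induction n arbitrary: g)
  case 0
  then show ?case using assms by (auto intro: continuous_on_compose2)
next
  case (Suc n)
  obtain g' where g': "\<And>x. x \<in> V \<Longrightarrow> (g has_derivative g' x) (at x)"
    "\<And>i. i \<in> Basis \<Longrightarrow> Ck_on n V (\<lambda>x. g' x i)"
    using Ck_onE[OF Suc.prems(1)] by blast
  obtain t' where t': "\<And>x. x \<in> U \<Longrightarrow> (t has_derivative t' x) (at x)"
    "\<And>i. i \<in> Basis \<Longrightarrow> Ck_on n U (\<lambda>x. t' x i)"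
    using Ck_onE[OF Suc.prems(2)] by blast
  have expand: "g' (t x) h = (\<Sum>j\<in>Basis. (h \<bullet> j) *\<^sub>R g' (t x) j)" if "x \<in> U" for x h
  proof -
    have "linear (g' (t x))"
      using g'(1) that assms has_derivative_linear by blast
    then show ?thesis by (rule linear_Basis_expansion)
  qed
  show ?case
  proof (rule Ck_onI[where f'="\<lambda>x h. \<Sum>j\<in>Basis. (t' x h \<bullet> j) *\<^sub>R g' (t x) j"])
    show "((\<lambda>x. g (t x)) has_derivative (\<lambda>h. \<Sum>j\<in>Basis. (t' x h \<bullet> j) *\<^sub>R g' (t x) j)) (at x)"
      if "x \<in> U" for x
    proof -
      have "((\<lambda>x. g (t x)) has_derivative (\<lambda>h. g' (t x) (t' x h))) (at x)"
        using has_derivative_compose[OF t'(1)[OF that] g'(1)] that assms by blast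
      moreover have "(\<lambda>h. g' (t x) (t' x h)) = (\<lambda>h. \<Sum>j\<in>Basis. (t' x h \<bullet> j) *\<^sub>R g' (t x) j)"
        by (rule ext) (rule expand[OF that])
      ultimately show ?thesis by (simp only:)
    qed
    show "Ck_on n U (\<lambda>x. \<Sum>j\<in>Basis. (t' x i \<bullet> j) *\<^sub>R g' (t x) j)" if "i \<in> Basis" for i
      by (rule Ck_on_sum[OF finite_Basis], rule Ck_on_scaleR)
        (rule Ck_on_bounded_linear[OF bounded_linear_inner_left t'(2)[OF that]],
         rule Suc.IH[OF g'(2) Ck_on_Suc_imp[OF Suc.prems(2)]])
  qed
qed

text \<open>Uniqueness of the derivative identifies the witness hidden in \<open>Ck_on\<close> with
  \<open>frechet_derivative\<close>, in terms of which \<open>iter_pd\<close> and therefore jets are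
  defined.\<close>

lemma Ck_on_frechet_derivative:
  assumes "open U" "Ck_on (Suc n) U f"
  shows "\<And>x. x \<in> U \<Longrightarrow> (f has_derivative frechet_derivative f (at x)) (at x)"
    and "\<And>i. i \<in> Basis \<Longrightarrow> Ck_on n U (\<lambda>x. frechet_derivative f (at x) i)"
proof -
  obtain f' where f': "\<And>x. x \<in> U \<Longrightarrow> (f has_derivative f' x) (at x)"
    "\<And>i. i \<in> Basis \<Longrightarrow> Ck_on n U (\<lambda>x. f' x i)"
    using Ck_onE[OF assms(2)] by blast
  have eq: "frechet_derivative f (at x) = f' x" if "x \<in> U" for x
    using frechet_derivative_at[OF f'(1)[OF that]] by simp
  show "(f has_derivative frechet_derivative f (at x)) (at x)" if "x \<in> U" for x
    using f' eq that by simp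
  show "Ck_on n U (\<lambda>x. frechet_derivative f (at x) i)" if "i \<in> Basis" for i
    using Ck_on_cong[OF assms(1) _ f'(2)[OF that], of "\<lambda>x. frechet_derivative f (at x) i"] eq
    by simp
qed

section \<open>Locality, linearity and continuity of iterated partial derivatives\<close>

lemma iter_pd_cong:
  assumes "open U" "x \<in> U"
  shows "(\<And>y. y \<in> U \<Longrightarrow> f y = g y) \<Longrightarrow> iter_pd is f x = iter_pd is g x"
proof (induction "is" arbitrary: f g)
  case Nil
  then show ?case using assms by simp
next
  case (Cons i "is")
  have fg: "frechet_derivative f (at y) = frechet_derivative g (at y)" if "y \<in> U" for y
  proof -
    have "(f has_derivative D) (at y) \<longleftrightarrow> (g has_derivative D) (at y)" for D
      using has_derivative_transform_within_open[OF _ assms(1) that, of f D UNIV g]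
        has_derivative_transform_within_open[OF _ assms(1) that, of g D UNIV f] Cons.prems by fastforce
    then show ?thesis unfolding frechet_derivative_def by simp
  qed
  show ?case
    unfolding iter_pd.simps by (rule Cons.IH) (simp only: fg)
qed

text \<open>Differentiability up to the length of the list is assumed because
  \<open>frechet_derivative\<close> is an arbitrary choice where no derivative exists, and then need
  not be additive.\<close>

lemma iter_pd_diff:
  assumes "open U" "x \<in> U"
  shows "Ck_on (length is) U f \<Longrightarrow> Ck_on (length is) U g \<Longrightarrow> set is \<subseteq> Basis \<Longrightarrow>
    iter_pd is (\<lambda>y. f y - g y) x = iter_pd is f x - iter_pd is g x"
proof (induction "is" arbitrary: f g)
  case (Cons i "is")
  note F = Ck_on_frechet_derivative[OF assms(1) Cons.prems(1)[unfolded list.size add_Suc_right add_0_right]]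
  note G = Ck_on_frechet_derivative[OF assms(1) Cons.prems(2)[unfolded list.size add_Suc_right add_0_right]]
  have i: "i \<in> Basis" and sub: "set is \<subseteq> Basis" using Cons.prems by auto
  have "frechet_derivative (\<lambda>y. f y - g y) (at y) i
      = frechet_derivative f (at y) i - frechet_derivative g (at y) i" if "y \<in> U" for y
    using frechet_derivative_at[OF has_derivative_diff[OF F(1)[OF that] G(1)[OF that]]]
    by (rule fun_cong[OF sym])
  then have "iter_pd (i # is) (\<lambda>y. f y - g y) x
      = iter_pd is (\<lambda>y. frechet_derivative f (at y) i - frechet_derivative g (at y) i) x"
    unfolding iter_pd.simps by (rule iter_pd_cong[OF assms])
  also have "\<dots> = iter_pd (i # is) f x - iter_pd (i # is) g x"
    unfolding iter_pd.simps by (rule Cons.IH[OF F(2)[OF i] G(2)[OF i] sub])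
  finally show ?case .
qed simp

lemma continuous_on_iter_pd:
  assumes "open U"
  shows "Ck_on (length is) U f \<Longrightarrow> set is \<subseteq> Basis \<Longrightarrow> continuous_on U (iter_pd is f)"
proof (induction "is" arbitrary: f)
  case (Cons i "is")
  then show ?case using Ck_on_frechet_derivative(2)[OF assms, of "length is" f i] by simp
qed simp

section \<open>Mean value estimates and Taylor bounds at the origin\<close>

lemma norm_diff_le_partials:
  fixes h :: "'a::euclidean_space \<Rightarrow> 'b::real_normed_vector"
  assumes "convex S" "x \<in> S" "y \<in> S"
    and der: "\<And>z. z \<in> S \<Longrightarrow> (h has_derivative h' z) (at z)"
    and bound: "\<And>z i. z \<in> S \<Longrightarrow> i \<in> Basis \<Longrightarrow> norm (h' z i) \<le> B"
  shows "norm (h y - h x) \<le> real DIM('a) * B * norm (y - x)"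
proof -
  have "onorm (h' z) \<le> real DIM('a) * B" if "z \<in> S" for z
  proof (rule onorm_bound)
    obtain i :: 'a where "i \<in> Basis" using nonempty_Basis by blast
    then have "0 \<le> B" using bound[OF that] norm_ge_zero order_trans by blast
    then show "0 \<le> real DIM('a) * B" by simp
    fix v :: 'a
    have "linear (h' z)" using der[OF that] has_derivative_linear by blast
    then have "h' z v = (\<Sum>j\<in>Basis. (v \<bullet> j) *\<^sub>R h' z j)"
      by (rule linear_Basis_expansion)
    also have "norm \<dots> \<le> (\<Sum>j\<in>(Basis::'a set). norm v * B)"
      by (rule sum_norm_le)
        (auto intro!: mult_mono bound[OF that] Basis_le_norm)
    finally show "norm (h' z v) \<le> real DIM('a) * B * norm v" by (simp add: mult_ac)
  qed
  then show ?thesis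
    using differentiable_bound[OF assms(1) has_derivative_at_withinI[OF der] _ assms(3,2)] by blast
qed

text \<open>The mean value inequality on the closed ball of radius \<open>norm x\<close> about 0:
  there the bound on the partial derivatives is at most \<open>M * norm x ^ k\<close>, and the
  length of the segment from 0 to \<open>x\<close> contributes one more power.\<close>

lemma norm_le_partials_power:
  fixes h :: "'a::euclidean_space \<Rightarrow> 'b::real_normed_vector"
  assumes "h 0 = 0" "0 \<le> M" "norm x < d"
    and der: "\<And>z. norm z < d \<Longrightarrow> (h has_derivative h' z) (at z)"
    and bound: "\<And>z i. norm z < d \<Longrightarrow> i \<in> Basis \<Longrightarrow> norm (h' z i) \<le> M * norm z ^ k"
  shows "norm (h x) \<le> real DIM('a) * M * norm x ^ Suc k"
proof -
  have "norm (h x - h 0) \<le> real DIM('a) * (M * norm x ^ k) * norm (x - 0)"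
  proof (rule norm_diff_le_partials[of "cball 0 (norm x)" 0 x h h'])
    show "norm (h' z i) \<le> M * norm x ^ k" if "z \<in> cball 0 (norm x)" "i \<in> Basis" for z i
    proof -
      have "norm (h' z i) \<le> M * norm z ^ k" using bound that assms(3) by simp
      also have "\<dots> \<le> M * norm x ^ k" using that assms(2) by (intro mult_left_mono power_mono) auto
      finally show ?thesis .
    qed
  qed (use der assms in auto)
  then show ?thesis using assms(1) by (simp add: mult_ac)
qed

text \<open>Taylor's theorem in little-o form for a vanishing \<open>r\<close>-jet. The partial
  derivatives have vanishing jets of one order less, and each induction step integrates their bound
  by the mean value inequality.\<close>

lemma jet_zero_imp_small:
  fixes h :: "'a::euclidean_space \<Rightarrow> 'b::real_normed_vector"
  assumes "open U" "0 \<in> U"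
  shows "Ck_on r U h \<Longrightarrow> (\<And>is. set is \<subseteq> Basis \<Longrightarrow> length is \<le> r \<Longrightarrow> iter_pd is h 0 = 0) \<Longrightarrow> e > 0 \<Longrightarrow>
    \<exists>d>0. \<forall>x. norm x < d \<longrightarrow> norm (h x) \<le> e * norm x ^ r"
proof (induction r arbitrary: h e)
  case 0
  have "h 0 = 0" using 0(2)[of "[]"] by simp
  moreover have "isCont h 0"
    using 0(1) assms by (simp add: continuous_on_eq_continuous_at)
  ultimately obtain d where "d > 0" "\<forall>x. dist x 0 < d \<longrightarrow> dist (h x) (h 0) < e"
    using \<open>e > 0\<close> unfolding continuous_at_eps_delta by blast
  then show ?case using \<open>h 0 = 0\<close> by (intro exI[of _ d]) (auto intro: less_imp_le)
next
  case (Suc r)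
  note D = Ck_on_frechet_derivative[OF assms(1) Suc.prems(1)]
  \<comment> \<open>This absorbs the factor \<open>DIM('a)\<close> that the mean value estimate
    costs.\<close>
  define e' where "e' = e / DIM('a)"
  have e': "e' > 0" using Suc.prems(3) unfolding e'_def by simp
  have "\<exists>d>0. \<forall>x. norm x < d \<longrightarrow> norm (frechet_derivative h (at x) i) \<le> e' * norm x ^ r"
    if "i \<in> Basis" for i
  proof (rule Suc.IH[OF D(2)[OF that] _ e'])
    show "iter_pd is (\<lambda>x. frechet_derivative h (at x) i) 0 = 0"
      if "set is \<subseteq> Basis" "length is \<le> r" for "is"
      using Suc.prems(2)[of "i # is"] that \<open>i \<in> Basis\<close> by simp
  qed
  then obtain d where d: "\<And>i. i \<in> Basis \<Longrightarrow> d i > 0" "\<And>i x. i \<in> Basis \<Longrightarrow> norm x < d i \<Longrightarrow>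
      norm (frechet_derivative h (at x) i) \<le> e' * norm x ^ r"
    by metis
  obtain d0 where d0: "d0 > 0" "ball 0 d0 \<subseteq> U"
    using assms open_contains_ball by blast
  define d1 where "d1 = Min (insert d0 (d ` Basis))"
  have d1: "d1 > 0" "d1 \<le> d0" "\<And>i. i \<in> Basis \<Longrightarrow> d1 \<le> d i"
    using d(1) d0 unfolding d1_def by (auto simp del: Min_insert intro: Min_le)
  have "norm (h x) \<le> e * norm x ^ Suc r" if "norm x < d1" for x
  proof -
    have "norm (h x) \<le> real DIM('a) * e' * norm x ^ Suc r"
    proof (rule norm_le_partials_power[OF _ _ that])
      show "h 0 = 0" using Suc.prems(2)[of "[]"] by simp
      show "0 \<le> e'" using e' by simp
      show "(h has_derivative frechet_derivative h (at z)) (at z)" if "norm z < d1" for z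
        using D(1) d0 d1 that by (auto simp: subset_iff)
      show "norm (frechet_derivative h (at z) i) \<le> e' * norm z ^ r" if "norm z < d1" "i \<in> Basis" for z i
        using d(2) d1(3) that by fastforce
    qed
    then show ?thesis unfolding e'_def by simp
  qed
  then show ?case using d1 by blast
qed

text \<open>The big-O counterpart: here only the derivatives of order below \<open>r\<close> vanish
  at 0, while those of order \<open>r\<close> are merely bounded nearby by continuity.\<close>

lemma jet_zero_imp_bounded:
  fixes h :: "'a::euclidean_space \<Rightarrow> 'b::real_normed_vector"
  assumes "open U" "0 \<in> U"
  shows "Ck_on r U h \<Longrightarrow> (\<And>is. set is \<subseteq> Basis \<Longrightarrow> length is < r \<Longrightarrow> iter_pd is h 0 = 0) \<Longrightarrow>
    \<exists>M\<ge>0. \<forall>\<^sub>F x in nhds 0. norm (h x) \<le> M * norm x ^ r"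
proof (induction r arbitrary: h)
  case 0
  have "isCont h 0"
    using 0(1) assms by (simp add: continuous_on_eq_continuous_at)
  then have "((\<lambda>x. norm (h x)) \<longlongrightarrow> norm (h 0)) (nhds 0)"
    by (intro tendsto_norm) (simp add: isCont_def tendsto_at_iff_tendsto_nhds)
  then have "\<forall>\<^sub>F x in nhds 0. norm (h x) < norm (h 0) + 1"
    by (rule order_tendstoD(2)) simp
  then have "\<forall>\<^sub>F x in nhds 0. norm (h x) \<le> (norm (h 0) + 1) * norm x ^ 0"
    by eventually_elim simp
  then show ?case by (intro exI[of _ "norm (h 0) + 1"]) auto
next
  case (Suc r)
  note D = Ck_on_frechet_derivative[OF assms(1) Suc.prems(1)]
  have "\<exists>M\<ge>0. \<forall>\<^sub>F x in nhds 0. norm (frechet_derivative h (at x) i) \<le> M * norm x ^ r"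
    if "i \<in> Basis" for i
  proof (rule Suc.IH[OF D(2)[OF that]])
    show "iter_pd is (\<lambda>x. frechet_derivative h (at x) i) 0 = 0"
      if "set is \<subseteq> Basis" "length is < r" for "is"
      using Suc.prems(2)[of "i # is"] that \<open>i \<in> Basis\<close> by simp
  qed
  then obtain M where M: "\<And>i. i \<in> Basis \<Longrightarrow> M i \<ge> 0" "\<And>i. i \<in> Basis \<Longrightarrow>
      \<forall>\<^sub>F x in nhds 0. norm (frechet_derivative h (at x) i) \<le> M i * norm x ^ r"
    by metis
  define K where "K = (\<Sum>i\<in>Basis. M i)"
  have MK: "M i \<le> K" if "i \<in> Basis" for i
    unfolding K_def using that M(1) by (intro member_le_sum) auto
  have K: "K \<ge> 0" unfolding K_def using M(1) by (rule sum_nonneg)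
  have "\<forall>\<^sub>F x in nhds 0. \<forall>i\<in>Basis. norm (frechet_derivative h (at x) i) \<le> M i * norm x ^ r"
    using M(2) by (simp add: eventually_ball_finite)
  moreover have "\<forall>\<^sub>F x in nhds 0. x \<in> U"
    using assms eventually_nhds_in_open by blast
  ultimately have "\<forall>\<^sub>F x in nhds 0. x \<in> U \<and>
      (\<forall>i\<in>Basis. norm (frechet_derivative h (at x) i) \<le> M i * norm x ^ r)"
    by eventually_elim simp
  then obtain d where d: "d > 0" "\<And>x. norm x < d \<Longrightarrow> x \<in> U"
      "\<And>x i. norm x < d \<Longrightarrow> i \<in> Basis \<Longrightarrow> norm (frechet_derivative h (at x) i) \<le> M i * norm x ^ r"
    unfolding eventually_nhds_metric by auto
  have "norm (h x) \<le> real DIM('a) * K * norm x ^ Suc r" if "norm x < d" for x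
  proof (rule norm_le_partials_power[OF _ K that])
    show "h 0 = 0" using Suc.prems(2)[of "[]"] by simp
    show "(h has_derivative frechet_derivative h (at z)) (at z)" if "norm z < d" for z
      using D(1) d(2) that by blast
    show "norm (frechet_derivative h (at z) i) \<le> K * norm z ^ r" if "norm z < d" "i \<in> Basis" for z i
      using d(3)[OF that] mult_right_mono[OF MK[OF that(2)], of "norm z ^ r"] by simp
  qed
  then have "\<forall>\<^sub>F x in nhds 0. norm (h x) \<le> real DIM('a) * K * norm x ^ Suc r"
    unfolding eventually_nhds_metric using d(1) by auto
  then show ?case using K by (intro exI[of _ "real DIM('a) * K"]) simp
qed

lemma quadratic_remainder:
  fixes t :: "'a::euclidean_space \<Rightarrow> 'b::real_normed_vector"
  assumes "open U" "0 \<in> U" "Ck_on 2 U t" "t 0 = 0" "(t has_derivative L) (at 0)"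
  shows "\<exists>M\<ge>0. \<forall>\<^sub>F x in nhds 0. norm (t x - L x) \<le> M * norm x ^ 2"
proof (rule jet_zero_imp_bounded[OF assms(1,2)])
  have L: "bounded_linear L" using assms(5) has_derivative_bounded_linear by blast
  show "Ck_on 2 U (\<lambda>x. t x - L x)"
    by (rule Ck_on_diff[OF assms(3) Ck_on_linear[OF L]])
  have "((\<lambda>x. t x - L x) has_derivative (\<lambda>x. L x - L x)) (at 0)"
    by (rule has_derivative_diff[OF assms(5) bounded_linear_imp_has_derivative[OF L]])
  then have "frechet_derivative (\<lambda>x. t x - L x) (at 0) = (\<lambda>x. 0)"
    using frechet_derivative_at by fastforce
  then show "iter_pd is (\<lambda>x. t x - L x) 0 = 0" if "set is \<subseteq> Basis" "length is < 2" for "is"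
    using that assms(4) linear_0[OF bounded_linear.linear[OF L]]
    by (cases "is") auto
qed

section \<open>Vanishing order\<close>

text \<open>For an open \<open>U\<close> containing 0 these are the smooth functions in the
  \<open>k\<close>-th power of the maximal ideal of germs at 0. The recursion through partial
  derivatives makes the product rule directly applicable.\<close>

fun vanishes_to_order :: "nat \<Rightarrow> 'a::euclidean_space set \<Rightarrow> ('a \<Rightarrow> 'b::real_normed_vector) \<Rightarrow> bool" where
  "vanishes_to_order 0 U f \<longleftrightarrow> (\<forall>n. Ck_on n U f)"
| "vanishes_to_order (Suc k) U f \<longleftrightarrow> f 0 = 0 \<and>
     (\<exists>f'. (\<forall>x\<in>U. (f has_derivative f' x) (at x)) \<and> (\<forall>i\<in>Basis. vanishes_to_order k U (\<lambda>x. f' x i)))"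

lemma vanishes_to_orderE:
  assumes "vanishes_to_order (Suc k) U f"
  obtains f' where "\<And>x. x \<in> U \<Longrightarrow> (f has_derivative f' x) (at x)"
    and "\<And>i. i \<in> Basis \<Longrightarrow> vanishes_to_order k U (\<lambda>x. f' x i)"
  using assms by (metis vanishes_to_order.simps(2))

lemma vanishes_imp_Ck_on: "vanishes_to_order k U f \<Longrightarrow> Ck_on n U f"
proof (induction k arbitrary: f n)
  case 0
  then show ?case by simp
next
  case (Suc k)
  have "Ck_on (Suc m) U f" for m
    using Suc.prems Suc.IH by fastforce
  then show ?case using Ck_on_Suc_imp by blast
qed

lemma vanishes_SucI:
  assumes "f 0 = 0"
    and "\<And>x. x \<in> U \<Longrightarrow> (f has_derivative f' x) (at x)"
    and "\<And>i. i \<in> Basis \<Longrightarrow> vanishes_to_order k U (\<lambda>x. f' x i)"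
  shows "vanishes_to_order (Suc k) U f"
  unfolding vanishes_to_order.simps by (intro exI[of _ f'] conjI ballI assms)

lemma vanishes_add:
  "vanishes_to_order k U f \<Longrightarrow> vanishes_to_order k U g \<Longrightarrow> vanishes_to_order k U (\<lambda>x. f x + g x)"
proof (induction k arbitrary: f g)
  case 0
  then show ?case by (auto intro: Ck_on_add)
next
  case (Suc k)
  obtain f' where f': "\<And>x. x \<in> U \<Longrightarrow> (f has_derivative f' x) (at x)"
    "\<And>i. i \<in> Basis \<Longrightarrow> vanishes_to_order k U (\<lambda>x. f' x i)"
    using vanishes_to_orderE[OF Suc.prems(1)] by blast
  obtain g' where g': "\<And>x. x \<in> U \<Longrightarrow> (g has_derivative g' x) (at x)"
    "\<And>i. i \<in> Basis \<Longrightarrow> vanishes_to_order k U (\<lambda>x. g' x i)"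
    using vanishes_to_orderE[OF Suc.prems(2)] by blast
  show ?case
    using f' g' Suc
    by (intro vanishes_SucI[where f'="\<lambda>x h. f' x h + g' x h"]) (auto intro: has_derivative_add)
qed

lemma vanishes_bounded_linear:
  assumes "bounded_linear l"
  shows "vanishes_to_order k U f \<Longrightarrow> vanishes_to_order k U (\<lambda>x. l (f x))"
proof (induction k arbitrary: f)
  case 0
  then show ?case using Ck_on_bounded_linear[OF assms] by auto
next
  case (Suc k)
  obtain f' where f': "\<And>x. x \<in> U \<Longrightarrow> (f has_derivative f' x) (at x)"
    "\<And>i. i \<in> Basis \<Longrightarrow> vanishes_to_order k U (\<lambda>x. f' x i)"
    using vanishes_to_orderE[OF Suc.prems] by blast
  show ?case
    using f' Suc assms linear_0[OF bounded_linear.linear[OF assms]]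
    by (intro vanishes_SucI[where f'="\<lambda>x h. l (f' x h)"]) (auto intro: bounded_linear.has_derivative)
qed

text \<open>By the product rule a partial derivative of \<open>l * h\<close> is \<open>l\<close>
  times one of \<open>h\<close>, handled by induction, plus a constant times \<open>h\<close>.
  Monomial factors can thus be counted one variable at a time.\<close>

lemma vanishes_linear_mult:
  fixes l h :: "'a::euclidean_space \<Rightarrow> real"
  assumes l: "bounded_linear l" and "open U"
  shows "vanishes_to_order k U h \<Longrightarrow> vanishes_to_order (Suc k) U (\<lambda>x. l x * h x)"
proof (induction k arbitrary: h)
  case 0
  then have h: "Ck_on n U h" for n by simp
  note D = Ck_on_frechet_derivative[OF \<open>open U\<close> h]
  show ?case
  proof (rule vanishes_SucI[where f'="\<lambda>x v. l x * frechet_derivative h (at x) v + l v * h x"])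
    show "l 0 * h 0 = 0" using linear_0[OF bounded_linear.linear[OF l]] by simp
    show "((\<lambda>x. l x * h x) has_derivative (\<lambda>v. l x * frechet_derivative h (at x) v + l v * h x)) (at x)"
      if "x \<in> U" for x
      using has_derivative_mult[OF bounded_linear_imp_has_derivative[OF l] D(1)[OF that]] .
    show "vanishes_to_order 0 U (\<lambda>x. l x * frechet_derivative h (at x) i + l i * h x)"
      if "i \<in> Basis" for i
      using D(2)[OF that] h by (auto intro!: Ck_on_add Ck_on_mult Ck_on_linear[OF l] Ck_on_const)
  qed
next
  case (Suc k)
  obtain h' where h': "\<And>x. x \<in> U \<Longrightarrow> (h has_derivative h' x) (at x)"
    "\<And>i. i \<in> Basis \<Longrightarrow> vanishes_to_order k U (\<lambda>x. h' x i)"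
    using vanishes_to_orderE[OF Suc.prems] by blast
  show ?case
  proof (rule vanishes_SucI[where f'="\<lambda>x v. l x * h' x v + l v * h x"])
    show "l 0 * h 0 = 0" using linear_0[OF bounded_linear.linear[OF l]] by simp
    show "((\<lambda>x. l x * h x) has_derivative (\<lambda>v. l x * h' x v + l v * h x)) (at x)" if "x \<in> U" for x
      using has_derivative_mult[OF bounded_linear_imp_has_derivative[OF l] h'(1)[OF that]] .
    show "vanishes_to_order (Suc k) U (\<lambda>x. l x * h' x i + l i * h x)" if "i \<in> Basis" for i
      using vanishes_add[OF Suc.IH[OF h'(2)[OF that]]
          vanishes_bounded_linear[OF bounded_linear_mult_right Suc.prems]] .
  qed
qed

lemma vanishes_imp_iter_pd_zero:
  assumes "open U" "0 \<in> U"
  shows "vanishes_to_order k U f \<Longrightarrow> set is \<subseteq> Basis \<Longrightarrow> length is < k \<Longrightarrow> iter_pd is f 0 = 0"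
proof (induction k arbitrary: f "is")
  case (Suc k)
  obtain f' where f': "\<And>x. x \<in> U \<Longrightarrow> (f has_derivative f' x) (at x)"
    "\<And>i. i \<in> Basis \<Longrightarrow> vanishes_to_order k U (\<lambda>x. f' x i)"
    using vanishes_to_orderE[OF Suc.prems(1)] by blast
  show ?case
  proof (cases "is")
    case Nil
    then show ?thesis using Suc.prems(1) by simp
  next
    case (Cons i js)
    have "iter_pd is f 0 = iter_pd js (\<lambda>x. f' x i) 0"
      unfolding Cons iter_pd.simps
      by (rule iter_pd_cong[OF assms]) (metis f'(1) frechet_derivative_at)
    then show ?thesis using Suc.IH[OF f'(2)] Suc.prems Cons by simp
  qed
qed simp

lemma vanishes_imp_small:
  fixes h :: "'a::euclidean_space \<Rightarrow> 'b::real_normed_vector"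
  assumes "open U" "0 \<in> U" "vanishes_to_order (Suc r) U h" "e > 0"
  shows "\<exists>d>0. \<forall>x. norm x < d \<longrightarrow> norm (h x) \<le> e * norm x ^ r"
proof (rule jet_zero_imp_small[OF assms(1,2) vanishes_imp_Ck_on[OF assms(3)] _ assms(4)])
  show "iter_pd is h 0 = 0" if "set is \<subseteq> Basis" "length is \<le> r" for "is"
    using vanishes_imp_iter_pd_zero[OF assms(1-3) that(1)] that(2) by (meson less_Suc_eq_le)
qed

lemma vanishes_1I:
  assumes "open U" "\<And>n. Ck_on n U f" "f 0 = 0"
  shows "vanishes_to_order (Suc 0) U f"
proof (rule vanishes_SucI[where f'="\<lambda>x. frechet_derivative f (at x)"])
  show "f 0 = 0" by (rule assms(3))
  show "(f has_derivative frechet_derivative f (at x)) (at x)" if "x \<in> U" for x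
    using Ck_on_frechet_derivative(1)[OF assms(1,2) that] .
  show "vanishes_to_order 0 U (\<lambda>x. frechet_derivative f (at x) i)" if "i \<in> Basis" for i
    unfolding vanishes_to_order.simps using Ck_on_frechet_derivative(2)[OF assms(1,2) that] by blast
qed

lemma vanishes_Suc_imp: "vanishes_to_order (Suc k) U f \<Longrightarrow> vanishes_to_order k U f"
proof (induction k arbitrary: f)
  case 0
  then show ?case unfolding vanishes_to_order.simps(1) using vanishes_imp_Ck_on by blast
next
  case (Suc k)
  obtain f' where f': "\<And>x. x \<in> U \<Longrightarrow> (f has_derivative f' x) (at x)"
    "\<And>i. i \<in> Basis \<Longrightarrow> vanishes_to_order (Suc k) U (\<lambda>x. f' x i)"
    using vanishes_to_orderE[OF Suc.prems] by blast
  have "f 0 = 0" using Suc.prems by simp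
  then show ?case
    by (rule vanishes_SucI[where f'=f']) (use f'(1) Suc.IH[OF f'(2)] in blast)+
qed

section \<open>Normal forms\<close>

text \<open>The shape shared by \<open>b\<close> and \<open>c\<close> in the normal form. Its middle
  term has order four, so the cubic part at 0 consists of two pure cubes with coefficients
  \<open>p1 0\<close> and \<open>p3 0\<close>.\<close>

definition cub :: "(real \<Rightarrow> real) \<Rightarrow> (real^2 \<Rightarrow> real) \<Rightarrow> (real \<Rightarrow> real) \<Rightarrow> real^2 \<Rightarrow> real" where
  "cub p1 p2 p3 x = (x$1)^3 * p1 (x$1) + (x$1)^2 * (x$2)^2 * p2 x + (x$2)^3 * p3 (x$2)"

lemma nf_map_nth:
  "nf_map a b1 b2 b3 c1 c2 c3 x $ 1 = (x$1)^2 - (x$2)^2"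
  "nf_map a b1 b2 b3 c1 c2 c3 x $ 2 = a * ((x$1)^2 + (x$2)^2) + cub b1 b2 b3 x"
  "nf_map a b1 b2 b3 c1 c2 c3 x $ 3 = cub c1 c2 c3 x"
  by (simp_all add: nf_map_def Let_def cub_def vector_3)

text \<open>Writing the map as scalar functions times constant vectors makes the closure rules for
  \<open>Ck_on\<close> apply to it.\<close>

lemma nf_map_axis:
  "nf_map a b1 b2 b3 c1 c2 c3 x = ((x$1)^2 - (x$2)^2) *\<^sub>R axis 1 1
     + (a * ((x$1)^2 + (x$2)^2) + cub b1 b2 b3 x) *\<^sub>R axis 2 1 + cub c1 c2 c3 x *\<^sub>R axis 3 1"
  by (simp add: vec_eq_iff forall_3 nf_map_nth axis_def)

text \<open>The one-variable coefficients are pulled back along the coordinate projections, so that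
  all six become functions on one neighbourhood of 0 in the plane.\<close>

lemma nf_dataE:
  assumes "nf_data a b1 b2 b3 c1 c2 c3"
  obtains U where "open U" "0 \<in> U"
    "\<And>n. Ck_on n U (\<lambda>x. b1 (x$1))" "\<And>n. Ck_on n U b2" "\<And>n. Ck_on n U (\<lambda>x. b3 (x$2))"
    "\<And>n. Ck_on n U (\<lambda>x. c1 (x$1))" "\<And>n. Ck_on n U c2" "\<And>n. Ck_on n U (\<lambda>x. c3 (x$2))"
proof -
  obtain W1 W2 where W1: "open W1" "0 \<in> W1" "smooth_on W1 b1" "smooth_on W1 b3" "smooth_on W1 c1" "smooth_on W1 c3"
    and W2: "open W2" "0 \<in> W2" "smooth_on W2 b2" "smooth_on W2 c2"
    using assms unfolding nf_data_def by blast
  define U where "U = ((\<lambda>x::real^2. x$1) -` W1 \<inter> (\<lambda>x. x$2) -` W1) \<inter> W2"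
  have "open ((\<lambda>x::real^2. x$i) -` W1)" for i
    by (rule open_vimage[OF W1(1)]) (intro continuous_intros)
  then have U: "open U" "0 \<in> U"
    unfolding U_def using W1 W2 by (auto intro!: open_Int)
  have 1: "Ck_on n U (\<lambda>x. p (x$1))" if "smooth_on W1 p" for n and p :: "real \<Rightarrow> real"
    by (rule Ck_on_compose[OF _ smooth_on_imp_Ck_on[OF that] Ck_on_linear[OF bounded_linear_vec_nth]])
      (auto simp: U_def)
  have 2: "Ck_on n U (\<lambda>x. p (x$2))" if "smooth_on W1 p" for n and p :: "real \<Rightarrow> real"
    by (rule Ck_on_compose[OF _ smooth_on_imp_Ck_on[OF that] Ck_on_linear[OF bounded_linear_vec_nth]])
      (auto simp: U_def)
  have 3: "Ck_on n U p" if "smooth_on W2 p" for n and p :: "real^2 \<Rightarrow> real"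
    by (rule Ck_on_subset[OF smooth_on_imp_Ck_on[OF that]]) (simp add: U_def)
  show thesis
    by (rule that[OF U 1[OF W1(3)] 3[OF W2(3)] 2[OF W1(4)] 1[OF W1(5)] 3[OF W2(4)] 2[OF W1(6)]])
qed

lemma nf_data_isCont:
  assumes "nf_data a b1 b2 b3 c1 c2 c3"
  shows "isCont b1 0" "isCont b2 0" "isCont b3 0" "isCont c1 0" "isCont c2 0" "isCont c3 0"
proof -
  have "isCont p 0" if "smooth_on W p" "open W" "0 \<in> W" for W and p :: "'c::euclidean_space \<Rightarrow> real"
    using Ck_on_imp_continuous[OF smooth_on_imp_Ck_on[OF that(1)]] that(2,3)
    by (simp add: continuous_on_eq_continuous_at)
  then show "isCont b1 0" "isCont b2 0" "isCont b3 0" "isCont c1 0" "isCont c2 0" "isCont c3 0"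
    using assms unfolding nf_data_def by blast+
qed

text \<open>Here \<open>k\<close> is the order contributed by \<open>p1\<close> and
  \<open>p3\<close>. The factor \<open>u^2 v^2\<close> already has order four, which suffices
  exactly for \<open>k \<le> 1\<close>. The case \<open>k = 0\<close> is used for smoothness and for
  the order of \<open>b\<close>, the case \<open>k = 1\<close> for differences of normal
  forms.\<close>

lemma cub_vanishes:
  assumes "open U" "k \<le> 1" "vanishes_to_order k U (\<lambda>x. p1 (x$1))" "\<And>n. Ck_on n U p2"
    "vanishes_to_order k U (\<lambda>x. p3 (x$2))"
  shows "vanishes_to_order (k + 3) U (cub p1 p2 p3)"
proof -
  note lm = vanishes_linear_mult[OF bounded_linear_vec_nth \<open>open U\<close>]
  have k3: "k + 3 = Suc (Suc (Suc k))" by simp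
  have 1: "vanishes_to_order (k + 3) U (\<lambda>x. (x$1)^3 * p1 (x$1))"
    unfolding k3 power3_eq_cube mult.assoc by (rule lm[OF lm[OF lm[OF assms(3)]]])
  have 3: "vanishes_to_order (k + 3) U (\<lambda>x. (x$2)^3 * p3 (x$2))"
    unfolding k3 power3_eq_cube mult.assoc by (rule lm[OF lm[OF lm[OF assms(5)]]])
  have p2: "vanishes_to_order 0 U p2" using assms(4) by simp
  have 4: "vanishes_to_order (Suc (Suc (Suc (Suc 0)))) U (\<lambda>x. (x$1)^2 * (x$2)^2 * p2 x)"
    unfolding power2_eq_square mult.assoc by (rule lm[OF lm[OF lm[OF lm[OF p2]]]])
  have "k = 0 \<or> k = 1" using assms(2) by auto
  then have 2: "vanishes_to_order (k + 3) U (\<lambda>x. (x$1)^2 * (x$2)^2 * p2 x)"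
  proof
    assume "k = 0"
    then show ?thesis unfolding k3 using vanishes_Suc_imp[OF 4] by (simp only:)
  next
    assume "k = 1"
    then show ?thesis unfolding k3 using 4 by (simp only: One_nat_def)
  qed
  show ?thesis
    using vanishes_add[OF vanishes_add[OF 1 2] 3] unfolding cub_def[abs_def] .
qed

lemma nf_map_Ck_on:
  assumes "open U" "\<And>n. Ck_on n U (\<lambda>x. b1 (x$1))" "\<And>n. Ck_on n U b2" "\<And>n. Ck_on n U (\<lambda>x. b3 (x$2))"
    "\<And>n. Ck_on n U (\<lambda>x. c1 (x$1))" "\<And>n. Ck_on n U c2" "\<And>n. Ck_on n U (\<lambda>x. c3 (x$2))"
  shows "Ck_on n U (nf_map a b1 b2 b3 c1 c2 c3)"
proof -
  have b: "Ck_on n U (cub b1 b2 b3)" and c: "Ck_on n U (cub c1 c2 c3)"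
    using assms by (auto intro!: vanishes_imp_Ck_on[OF cub_vanishes[where k=0]])
  have x: "Ck_on n U (\<lambda>x::real^2. x$i)" for i
    by (rule Ck_on_linear[OF bounded_linear_vec_nth])
  have u: "Ck_on n U (\<lambda>x::real^2. (x$1)^2 - (x$2)^2)"
    unfolding power2_eq_square by (intro Ck_on_diff Ck_on_mult x)
  have v: "Ck_on n U (\<lambda>x::real^2. a * ((x$1)^2 + (x$2)^2) + cub b1 b2 b3 x)"
    unfolding power2_eq_square by (intro Ck_on_add Ck_on_mult x b Ck_on_const)
  show ?thesis
    unfolding nf_map_axis[abs_def] by (intro Ck_on_add Ck_on_scaleR u v c Ck_on_const)
qed

lemma nf_map_jet_eqI:
  assumes "nf_data a b1 b2 b3 c1 c2 c3" "nf_data a hb1 hb2 hb3 hc1 hc2 hc3"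
    "b1 0 = hb1 0" "b3 0 = hb3 0" "c1 0 = hc1 0" "c3 0 = hc3 0"
  shows "jet_eq 3 (nf_map a b1 b2 b3 c1 c2 c3) (nf_map a hb1 hb2 hb3 hc1 hc2 hc3) 0"
proof -
  obtain U where U: "open U" "0 \<in> U"
    "\<And>n. Ck_on n U (\<lambda>x. b1 (x$1))" "\<And>n. Ck_on n U b2" "\<And>n. Ck_on n U (\<lambda>x. b3 (x$2))"
    "\<And>n. Ck_on n U (\<lambda>x. c1 (x$1))" "\<And>n. Ck_on n U c2" "\<And>n. Ck_on n U (\<lambda>x. c3 (x$2))"
    using nf_dataE[OF assms(1)] by blast
  obtain V where V: "open V" "0 \<in> V"
    "\<And>n. Ck_on n V (\<lambda>x. hb1 (x$1))" "\<And>n. Ck_on n V hb2" "\<And>n. Ck_on n V (\<lambda>x. hb3 (x$2))"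
    "\<And>n. Ck_on n V (\<lambda>x. hc1 (x$1))" "\<And>n. Ck_on n V hc2" "\<And>n. Ck_on n V (\<lambda>x. hc3 (x$2))"
    using nf_dataE[OF assms(2)] by blast
  define W where "W = U \<inter> V"
  have W: "open W" "0 \<in> W" using U V unfolding W_def by auto
  note CU = Ck_on_subset[of _ U _ W, OF _ Int_lower1[of U V, folded W_def]]
  note CV = Ck_on_subset[of _ V _ W, OF _ Int_lower2[of U V, folded W_def]]
  let ?f = "nf_map a b1 b2 b3 c1 c2 c3" and ?g = "nf_map a hb1 hb2 hb3 hc1 hc2 hc3"
  \<comment> \<open>The difference of two maps with the same \<open>a\<close> has \<open>db\<close>
    and \<open>dc\<close> as its only nonzero coordinates. Their outer coefficients vanish at 0 by
    assumption, so both have order four and do not affect the 3-jet.\<close>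
  define db where "db = cub (\<lambda>u. b1 u - hb1 u) (\<lambda>x. b2 x - hb2 x) (\<lambda>u. b3 u - hb3 u)"
  define dc where "dc = cub (\<lambda>u. c1 u - hc1 u) (\<lambda>x. c2 x - hc2 x) (\<lambda>u. c3 u - hc3 u)"
  have "vanishes_to_order (1 + 3) W db"
    unfolding db_def using U V assms(3,4)
    by (intro cub_vanishes[OF W(1)] vanishes_1I[OF W(1), folded One_nat_def] Ck_on_diff CU CV) auto
  moreover have "vanishes_to_order (1 + 3) W dc"
    unfolding dc_def using U V assms(5,6)
    by (intro cub_vanishes[OF W(1)] vanishes_1I[OF W(1), folded One_nat_def] Ck_on_diff CU CV) auto
  ultimately have "vanishes_to_order (1 + 3) W (\<lambda>x. db x *\<^sub>R (axis 2 1 :: real^3) + dc x *\<^sub>R axis 3 1)"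
    by (intro vanishes_add vanishes_bounded_linear[OF bounded_linear_scaleR_left])
  moreover have "(\<lambda>x. db x *\<^sub>R (axis 2 1 :: real^3) + dc x *\<^sub>R axis 3 1) = (\<lambda>x. ?f x - ?g x)"
    by (rule ext) (simp add: vec_eq_iff forall_3 nf_map_nth axis_def db_def dc_def cub_def algebra_simps)
  ultimately have van: "vanishes_to_order (1 + 3) W (\<lambda>x. ?f x - ?g x)" by (simp only:)
  have f: "Ck_on n W ?f" and g: "Ck_on n W ?g" for n
    by (rule CU[OF nf_map_Ck_on[OF U(1,3-8)]], rule CV[OF nf_map_Ck_on[OF V(1,3-8)]])
  have "iter_pd is ?f 0 = iter_pd is ?g 0" if "set is \<subseteq> Basis" "length is \<le> 3" for "is"
    using iter_pd_diff[OF W f g that(1)] vanishes_imp_iter_pd_zero[OF W van that(1)] that(2) by simp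
  then show ?thesis unfolding jet_eq_def by blast
qed

section \<open>Homogeneous parts as limits along rays\<close>

lemma cub_scaled_tendsto:
  assumes "isCont p1 0" "isCont p2 0" "isCont p3 0" and y: "(y \<longlongrightarrow> y0) (at_right 0)"
  shows "((\<lambda>\<tau>. cub p1 p2 p3 (\<tau> *\<^sub>R y \<tau>) / \<tau>^3) \<longlongrightarrow> p1 0 * (y0$1)^3 + p3 0 * (y0$2)^3) (at_right 0)"
proof -
  have id: "((\<lambda>\<tau>. \<tau>) \<longlongrightarrow> (0::real)) (at_right 0)" by (rule tendsto_ident_at)
  have yi: "((\<lambda>\<tau>. y \<tau> $ i) \<longlongrightarrow> y0 $ i) (at_right 0)" for i
    by (rule tendsto_vec_nth[OF y])
  have s0: "((\<lambda>\<tau>. \<tau> *\<^sub>R y \<tau>) \<longlongrightarrow> 0) (at_right 0)"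
    using tendsto_scaleR[OF id y] by simp
  have si: "((\<lambda>\<tau>. (\<tau> *\<^sub>R y \<tau>) $ i) \<longlongrightarrow> 0) (at_right 0)" for i
    using tendsto_vec_nth[OF s0, of i] by simp
  \<comment> \<open>After division by \<open>\<tau>^3\<close> the middle term, of degree four, keeps
    a factor \<open>\<tau>\<close> and disappears in the limit.\<close>
  have "((\<lambda>\<tau>. (y \<tau>$1)^3 * p1 ((\<tau> *\<^sub>R y \<tau>)$1) + \<tau> * ((y \<tau>$1)^2 * (y \<tau>$2)^2 * p2 (\<tau> *\<^sub>R y \<tau>))
      + (y \<tau>$2)^3 * p3 ((\<tau> *\<^sub>R y \<tau>)$2))
    \<longlongrightarrow> (y0$1)^3 * p1 0 + 0 * ((y0$1)^2 * (y0$2)^2 * p2 0) + (y0$2)^3 * p3 0) (at_right 0)"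
    by (intro tendsto_add tendsto_mult tendsto_power yi id isCont_tendsto_compose[OF assms(1)]
        isCont_tendsto_compose[OF assms(2)] isCont_tendsto_compose[OF assms(3)] si s0)
  moreover have "\<forall>\<^sub>F \<tau> in at_right 0. (y \<tau>$1)^3 * p1 ((\<tau> *\<^sub>R y \<tau>)$1)
      + \<tau> * ((y \<tau>$1)^2 * (y \<tau>$2)^2 * p2 (\<tau> *\<^sub>R y \<tau>)) + (y \<tau>$2)^3 * p3 ((\<tau> *\<^sub>R y \<tau>)$2)
      = cub p1 p2 p3 (\<tau> *\<^sub>R y \<tau>) / \<tau>^3"
    using eventually_at_right_less[of "0::real"]
  proof eventually_elim
    case (elim \<tau>)
    then show ?case
      by (simp add: cub_def field_simps power2_eq_square power3_eq_cube)
  qed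
  ultimately have "((\<lambda>\<tau>. cub p1 p2 p3 (\<tau> *\<^sub>R y \<tau>) / \<tau>^3)
      \<longlongrightarrow> (y0$1)^3 * p1 0 + 0 * ((y0$1)^2 * (y0$2)^2 * p2 0) + (y0$2)^3 * p3 0) (at_right 0)"
    by (rule Lim_transform_eventually)
  then show ?thesis by (simp add: mult.commute)
qed

lemma nf_map_scaled_tendsto:
  assumes "nf_data a b1 b2 b3 c1 c2 c3" and y: "(y \<longlongrightarrow> y0) (at_right 0)"
  shows "((\<lambda>\<tau>. nf_map a b1 b2 b3 c1 c2 c3 (\<tau> *\<^sub>R y \<tau>) $ 1 / \<tau>^2) \<longlongrightarrow> (y0$1)^2 - (y0$2)^2) (at_right 0)" (is ?t1)
    and "((\<lambda>\<tau>. nf_map a b1 b2 b3 c1 c2 c3 (\<tau> *\<^sub>R y \<tau>) $ 2 / \<tau>^2) \<longlongrightarrow> a * ((y0$1)^2 + (y0$2)^2)) (at_right 0)" (is ?t2)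
    and "((\<lambda>\<tau>. nf_map a b1 b2 b3 c1 c2 c3 (\<tau> *\<^sub>R y \<tau>) $ 3 / \<tau>^2) \<longlongrightarrow> 0) (at_right 0)" (is ?t3)
    and "((\<lambda>\<tau>. nf_map a b1 b2 b3 c1 c2 c3 (\<tau> *\<^sub>R y \<tau>) $ 3 / \<tau>^3) \<longlongrightarrow> c1 0 * (y0$1)^3 + c3 0 * (y0$2)^3) (at_right 0)" (is ?t4)
proof -
  note ct = nf_data_isCont[OF assms(1)]
  note B = cub_scaled_tendsto[OF ct(1-3) y] and C = cub_scaled_tendsto[OF ct(4-6) y]
  have id: "((\<lambda>\<tau>. \<tau>) \<longlongrightarrow> (0::real)) (at_right 0)" by (rule tendsto_ident_at)
  have yi: "((\<lambda>\<tau>. y \<tau> $ i) \<longlongrightarrow> y0 $ i) (at_right 0)" for i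
    by (rule tendsto_vec_nth[OF y])
  note pos = eventually_at_right_less[of "0::real"]
  have "((\<lambda>\<tau>. (y \<tau>$1)^2 - (y \<tau>$2)^2) \<longlongrightarrow> (y0$1)^2 - (y0$2)^2) (at_right 0)"
    by (intro tendsto_diff tendsto_power yi)
  moreover have "\<forall>\<^sub>F \<tau> in at_right 0. (y \<tau>$1)^2 - (y \<tau>$2)^2 = nf_map a b1 b2 b3 c1 c2 c3 (\<tau> *\<^sub>R y \<tau>) $ 1 / \<tau>^2"
    using pos by eventually_elim (simp add: nf_map_nth power_mult_distrib field_simps)
  ultimately show ?t1 by (rule Lim_transform_eventually)
  have "((\<lambda>\<tau>. a * ((y \<tau>$1)^2 + (y \<tau>$2)^2) + \<tau> * (cub b1 b2 b3 (\<tau> *\<^sub>R y \<tau>) / \<tau>^3))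
      \<longlongrightarrow> a * ((y0$1)^2 + (y0$2)^2) + 0 * (b1 0 * (y0$1)^3 + b3 0 * (y0$2)^3)) (at_right 0)"
    by (intro tendsto_add tendsto_mult tendsto_const tendsto_power yi id B)
  moreover have "\<forall>\<^sub>F \<tau> in at_right 0. a * ((y \<tau>$1)^2 + (y \<tau>$2)^2) + \<tau> * (cub b1 b2 b3 (\<tau> *\<^sub>R y \<tau>) / \<tau>^3)
      = nf_map a b1 b2 b3 c1 c2 c3 (\<tau> *\<^sub>R y \<tau>) $ 2 / \<tau>^2"
    using pos by eventually_elim (simp add: nf_map_nth power_mult_distrib field_simps power2_eq_square power3_eq_cube)
  ultimately show ?t2 using Lim_transform_eventually by fastforce
  have "((\<lambda>\<tau>. \<tau> * (cub c1 c2 c3 (\<tau> *\<^sub>R y \<tau>) / \<tau>^3))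
      \<longlongrightarrow> 0 * (c1 0 * (y0$1)^3 + c3 0 * (y0$2)^3)) (at_right 0)"
    by (intro tendsto_mult id C)
  moreover have "\<forall>\<^sub>F \<tau> in at_right 0. \<tau> * (cub c1 c2 c3 (\<tau> *\<^sub>R y \<tau>) / \<tau>^3)
      = nf_map a b1 b2 b3 c1 c2 c3 (\<tau> *\<^sub>R y \<tau>) $ 3 / \<tau>^2"
    using pos by eventually_elim (simp add: nf_map_nth field_simps power2_eq_square power3_eq_cube)
  ultimately show ?t3 using Lim_transform_eventually by fastforce
  show ?t4 unfolding nf_map_nth by (rule C)
qed

text \<open>Supplies the convergent direction \<open>y\<close> for the limits above when a germ
  \<open>t\<close> is substituted: \<open>t (\<tau> w)\<close> is \<open>\<tau>\<close> times a
  vector tending to \<open>L w\<close>.\<close>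

lemma has_derivative_ray_tendsto:
  fixes t :: "real^'n \<Rightarrow> real^'m"
  assumes "(t has_derivative L) (at 0)" "t 0 = 0"
  shows "((\<lambda>\<tau>. (1 / \<tau>) *\<^sub>R t (\<tau> *\<^sub>R w)) \<longlongrightarrow> L w) (at_right 0)"
proof (rule vec_tendstoI)
  fix i
  have L: "linear L" using assms(1) has_derivative_linear by blast
  have "((\<lambda>\<tau>. t (\<tau> *\<^sub>R w)) has_derivative (\<lambda>h. L (h *\<^sub>R w))) (at 0)"
    by (rule has_derivative_compose[of "\<lambda>\<tau>. \<tau> *\<^sub>R w" "\<lambda>h. h *\<^sub>R w"])
      (use assms in \<open>auto intro!: derivative_eq_intros\<close>)
  then have "((\<lambda>\<tau>. t (\<tau> *\<^sub>R w) $ i) has_derivative (\<lambda>h. L (h *\<^sub>R w) $ i)) (at 0)"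
    by (rule bounded_linear.has_derivative[OF bounded_linear_vec_nth])
  then have "((\<lambda>\<tau>. t (\<tau> *\<^sub>R w) $ i) has_real_derivative (L w $ i)) (at 0)"
    unfolding has_field_derivative_def by (simp add: linear_scale[OF L] mult_commute_abs)
  then have "((\<lambda>\<tau>. t (\<tau> *\<^sub>R w) $ i / \<tau>) \<longlongrightarrow> L w $ i) (at 0)"
    using assms(2) unfolding DERIV_def by simp
  then have "((\<lambda>\<tau>. t (\<tau> *\<^sub>R w) $ i / \<tau>) \<longlongrightarrow> L w $ i) (at_right 0)"
    by (simp add: filterlim_at_split)
  then show "((\<lambda>\<tau>. ((1 / \<tau>) *\<^sub>R t (\<tau> *\<^sub>R w)) $ i) \<longlongrightarrow> L w $ i) (at_right 0)" by simp
qed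

lemma small_ray_tendsto:
  fixes h :: "'a::real_normed_vector \<Rightarrow> real^'n"
  assumes small: "\<And>e. e > 0 \<Longrightarrow> \<exists>d>0. \<forall>x. norm x < d \<longrightarrow> norm (h x) \<le> e * norm x ^ r"
  shows "((\<lambda>\<tau>. h (\<tau> *\<^sub>R w) $ i / \<tau> ^ r) \<longlongrightarrow> 0) (at_right 0)"
proof (rule tendstoI)
  fix e :: real assume "e > 0"
  \<comment> \<open>Adding 1 keeps the denominator positive when \<open>w = 0\<close>, and the
    factor 2 makes the final inequality strict.\<close>
  define e' where "e' = e / (2 * (norm w ^ r + 1))"
  have n: "norm w ^ r + 1 > 0" by (simp add: add_nonneg_pos)
  have e': "e' > 0" using \<open>e > 0\<close> n unfolding e'_def by simp
  have ee: "e' * norm w ^ r < e"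
  proof -
    have "e' * norm w ^ r \<le> e' * (norm w ^ r + 1)" using e' by simp
    also have "\<dots> = e / 2" using n unfolding e'_def by (simp add: field_simps)
    finally show ?thesis using \<open>e > 0\<close> by simp
  qed
  obtain d where d: "d > 0" "\<And>x. norm x < d \<Longrightarrow> norm (h x) \<le> e' * norm x ^ r"
    using small[OF e'] by blast
  have "((\<lambda>\<tau>. norm (\<tau> *\<^sub>R w)) \<longlongrightarrow> norm ((0::real) *\<^sub>R w)) (at_right 0)"
    by (intro tendsto_intros)
  then have "\<forall>\<^sub>F \<tau> in at_right 0. norm (\<tau> *\<^sub>R w) < d"
    by (rule order_tendstoD(2)) (use d in simp)
  then show "\<forall>\<^sub>F \<tau> in at_right 0. dist (h (\<tau> *\<^sub>R w) $ i / \<tau> ^ r) 0 < e"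
    using eventually_at_right_less[of "0::real"]
  proof eventually_elim
    case (elim \<tau>)
    have "\<bar>h (\<tau> *\<^sub>R w) $ i\<bar> \<le> norm (h (\<tau> *\<^sub>R w))" by (rule component_le_norm_cart)
    also have "\<dots> \<le> e' * norm (\<tau> *\<^sub>R w) ^ r" using d(2) elim(1) by blast
    also have "\<dots> = (e' * norm w ^ r) * \<tau> ^ r" using elim(2) by (simp add: power_mult_distrib)
    also have "\<dots> < e * \<tau> ^ r" using ee elim(2) by simp
    finally show ?case using elim(2) by (simp add: divide_less_eq)
  qed
qed

section \<open>Rigidity of 3-jets\<close>

lemma rotation_row_col:
  fixes A :: "real^3^3"
  assumes "rotation_matrix A"
  shows "(\<Sum>k\<in>UNIV. A$k$i * A$k$j) = (if i = j then 1 else 0)"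
    and "(\<Sum>k\<in>UNIV. A$i$k * A$j$k) = (if i = j then 1 else 0)"
proof -
  have 1: "transpose A ** A = mat 1" and 2: "A ** transpose A = mat 1"
    using assms unfolding rotation_matrix_def orthogonal_matrix_def by auto
  have "(transpose A ** A)$i$j = (if i = j then 1 else 0)"
    unfolding 1 by (simp add: mat_def)
  then show "(\<Sum>k\<in>UNIV. A$k$i * A$k$j) = (if i = j then 1 else 0)"
    by (simp add: matrix_matrix_mult_def transpose_def)
  have "(A ** transpose A)$i$j = (if i = j then 1 else 0)"
    unfolding 2 by (simp add: mat_def)
  then show "(\<Sum>k\<in>UNIV. A$i$k * A$j$k) = (if i = j then 1 else 0)"
    by (simp add: matrix_matrix_mult_def transpose_def)
qed

text \<open>Vanishing of the \<open>u^2 v\<close> and \<open>u v^2\<close> coefficients gives two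
  relations whose combinations are multiples of \<open>r t\<close> and of \<open>p q\<close> by the
  nonzero determinant, so each row of the matrix contains a zero. If \<open>p = 0\<close>, then also
  \<open>t = 0\<close> and \<open>q r < 0\<close>, and the product \<open>k k'\<close> would have
  the sign of \<open>(q r)^3\<close>, contradicting positivity.\<close>

lemma cubic_forms_diagonal:
  fixes p q r t c c' k k' e :: real
  assumes det: "p * t - q * r > 0" and pos: "c > 0" "c' > 0" "k > 0" "k' > 0"
    and eq: "\<And>u v. e * (c * (p * u + q * v) ^ 3 + c' * (r * u + t * v) ^ 3) = k * u ^ 3 + k' * v ^ 3"
  shows "q = 0" "r = 0" "e * c * p ^ 3 = k" "e * c' * t ^ 3 = k'"
proof -
  have k: "e * (c * p ^ 3 + c' * r ^ 3) = k" using eq[of 1 0] by simp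
  have k': "e * (c * q ^ 3 + c' * t ^ 3) = k'" using eq[of 0 1] by simp
  have e0: "e \<noteq> 0" using k pos by auto
  have s1: "e * (c * (p + q) ^ 3 + c' * (r + t) ^ 3) = k + k'" using eq[of 1 1] by simp
  have s2: "e * (c * (p - q) ^ 3 + c' * (r - t) ^ 3) = k - k'" using eq[of 1 "-1"] by simp
  \<comment> \<open>The difference of the values at \<open>(1, 1)\<close> and \<open>(1, -1)\<close>
    isolates the odd part in \<open>v\<close>; removing the pure cube \<open>k'\<close> leaves the
    \<open>u^2 v\<close> coefficient. The sum does the same for \<open>u v^2\<close> below.\<close>
  have "e * (6 * (c * p\<^sup>2 * q + c' * r\<^sup>2 * t)) = 0"
    using s1 s2 k k' by algebra
  then have m1: "c * p\<^sup>2 * q + c' * r\<^sup>2 * t = 0" using e0 by simp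
  have "e * (6 * (c * p * q\<^sup>2 + c' * r * t\<^sup>2)) = 0"
    using s1 s2 k k' by algebra
  then have m2: "c * p * q\<^sup>2 + c' * r * t\<^sup>2 = 0" using e0 by simp
  have "c' * (r * t * (p * t - q * r)) = 0" using m1 m2 by algebra
  then have rt: "r * t = 0" using det pos by auto
  have "c * (p * q * (p * t - q * r)) = 0" using m1 m2 by algebra
  then have pq: "p * q = 0" using det pos by auto
  have "p \<noteq> 0"
  proof
    assume p: "p = 0"
    then have qr: "q * r < 0" using det by simp
    then have t: "t = 0" using rt by auto
    have "k * k' = e\<^sup>2 * c * c' * (q * r) ^ 3"
    proof -
      have "k = e * c' * r ^ 3" "k' = e * c * q ^ 3" using k k' p t by simp_all
      then show ?thesis by (simp add: power2_eq_square power_mult_distrib)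
    qed
    moreover have "(q * r) ^ 3 < 0" using qr by (simp add: power_less_zero_eq)
    moreover have "e\<^sup>2 * c * c' > 0" using e0 pos by simp
    ultimately have "k * k' < 0" by (simp add: mult_pos_neg)
    then show False using pos by (simp add: mult_less_0_iff)
  qed
  then show q: "q = 0" using pq by simp
  then show r: "r = 0" using rt det by auto
  show "e * c * p ^ 3 = k" "e * c' * t ^ 3 = k'" using k k' q r by simp_all
qed

text \<open>Once the third row and the third column of \<open>A\<close> reduce to their last entry,
  the upper block is orthogonal. Comparing lengths of vectors and their images under this block
  yields \<open>p^2 = t^2\<close>, after which the linear relations make the block diagonal.
  Positivity then fixes every remaining sign.\<close>

lemma normal_form_rigidity_algebra:
  fixes A :: "real^3^3" and p q r t a a' c c' k k' :: real
  assumes rot: "rotation_matrix A" and det: "p * t - q * r > 0"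
    and pos: "a > 0" "a' > 0" "c > 0" "c' > 0" "k > 0" "k' > 0"
    and row1: "\<And>u v. A$1$1 * ((p * u + q * v)\<^sup>2 - (r * u + t * v)\<^sup>2)
        + A$1$2 * (a * ((p * u + q * v)\<^sup>2 + (r * u + t * v)\<^sup>2)) = u\<^sup>2 - v\<^sup>2"
    and row2: "\<And>u v. A$2$1 * ((p * u + q * v)\<^sup>2 - (r * u + t * v)\<^sup>2)
        + A$2$2 * (a * ((p * u + q * v)\<^sup>2 + (r * u + t * v)\<^sup>2)) = a' * (u\<^sup>2 + v\<^sup>2)"
    and row3: "A$3$1 = 0" "A$3$2 = 0"
    and cubic: "\<And>u v. A$3$3 * (c * (p * u + q * v) ^ 3 + c' * (r * u + t * v) ^ 3)
        = k * u ^ 3 + k' * v ^ 3"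
  shows "A = mat 1" "p = 1" "q = 0" "r = 0" "t = 1" "a = a'" "c = k" "c' = k'"
proof -
  note rc = rotation_row_col[OF rot]
  \<comment> \<open>The last row and the last column are both unit vectors; since the row is
    concentrated in the corner entry, so is the column.\<close>
  have "(A$3$3)\<^sup>2 = 1"
    using rc(2)[of 3 3] row3 by (simp add: sum_3 power2_eq_square)
  moreover have "(A$1$3)\<^sup>2 + (A$2$3)\<^sup>2 + (A$3$3)\<^sup>2 = 1"
    using rc(1)[of 3 3] by (simp add: sum_3 power2_eq_square)
  ultimately have col3: "A$1$3 = 0" "A$2$3 = 0"
    by (simp_all add: sum_power2_eq_zero_iff)
  have o: "(A$1$1)\<^sup>2 + (A$2$1)\<^sup>2 = 1" "(A$1$2)\<^sup>2 + (A$2$2)\<^sup>2 = 1" "A$1$1 * A$1$2 + A$2$1 * A$2$2 = 0"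
    using rc(1)[of 1 1] rc(1)[of 2 2] rc(1)[of 1 2] row3 by (simp_all add: sum_3 power2_eq_square)
  have "det A = 1" using rot unfolding rotation_matrix_def by simp
  then have d: "A$3$3 * (A$1$1 * A$2$2 - A$1$2 * A$2$1) = 1"
    using row3 col3 by (simp add: det_3 algebra_simps)
  note D = cubic_forms_diagonal[OF det pos(3-6) cubic]
  show q: "q = 0" and r: "r = 0" using D by auto
  have p0: "p \<noteq> 0" and t0: "t \<noteq> 0" using det q by auto
  have e1: "A$1$1 * p\<^sup>2 + A$1$2 * (a * p\<^sup>2) = 1" "A$2$1 * p\<^sup>2 + A$2$2 * (a * p\<^sup>2) = a'"
    using row1[of 1 0] row2[of 1 0] r by simp_all
  have e2: "- A$1$1 * t\<^sup>2 + A$1$2 * (a * t\<^sup>2) = - 1" "- A$2$1 * t\<^sup>2 + A$2$2 * (a * t\<^sup>2) = a'"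
    using row1[of 0 1] row2[of 0 1] q by simp_all
  \<comment> \<open>The block sends \<open>(p^2, a p^2)\<close> to \<open>(1, a')\<close>, and
    likewise \<open>(-t^2, a t^2)\<close> to \<open>(-1, a')\<close>. An orthogonal map preserves
    length.\<close>
  have "(p\<^sup>2)\<^sup>2 * (1 + a\<^sup>2) = 1 + a'\<^sup>2" using e1 o by algebra
  moreover have "(t\<^sup>2)\<^sup>2 * (1 + a\<^sup>2) = 1 + a'\<^sup>2" using e2 o by algebra
  ultimately have "(p\<^sup>2)\<^sup>2 * (1 + a\<^sup>2) = (t\<^sup>2)\<^sup>2 * (1 + a\<^sup>2)" by simp
  moreover have "1 + a\<^sup>2 \<noteq> 0" by (smt (verit) zero_le_power2)
  ultimately have "(p\<^sup>2)\<^sup>2 = (t\<^sup>2)\<^sup>2" by simp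
  then have pt: "t\<^sup>2 = p\<^sup>2" using power2_eq_imp_eq by (metis zero_le_power2)
  have "2 * (A$1$2 * (a * p\<^sup>2)) = 0" using e1(1) e2(1)[unfolded pt] by linarith
  then have A12: "A$1$2 = 0" using pos p0 by simp
  have "2 * (A$2$1 * p\<^sup>2) = 0" using e1(2) e2(2)[unfolded pt] by linarith
  then have A21: "A$2$1 = 0" using p0 by simp
  have "(A$1$1)\<^sup>2 = 1" using o A21 by simp
  moreover have "A$1$1 > 0" using e1(1) A12 p0
    by (metis add.right_neutral mult_zero_left zero_less_mult_pos2 zero_less_one zero_less_power2)
  ultimately have A11: "A$1$1 = 1" by (simp add: power2_eq_1_iff)
  then have p2: "p\<^sup>2 = 1" using e1(1) A12 by simp
  have "(A$2$2)\<^sup>2 = 1" using o A12 by simp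
  moreover have "A$2$2 * a = a'" using e1(2) A21 p2 by simp
  then have "A$2$2 > 0" using pos by (metis zero_less_mult_pos2)
  ultimately have A22: "A$2$2 = 1" by (simp add: power2_eq_1_iff)
  then show "a = a'" using \<open>A$2$2 * a = a'\<close> by simp
  have A33: "A$3$3 = 1" using d A11 A22 A12 by simp
  show "A = mat 1"
    using row3 col3 A11 A22 A33 A12 A21 by (simp add: vec_eq_iff forall_3 mat_def)
  \<comment> \<open>The quadratic part determines \<open>p\<close> and \<open>t\<close> only up to
    sign; the cubic part supplies the sign.\<close>
  have "p ^ 3 > 0" using D(3) pos A33 by (metis mult_1 zero_less_mult_pos)
  then show p: "p = 1" using p2 by (auto simp: power2_eq_1_iff)
  have "t ^ 3 > 0" using D(4) pos A33 by (metis mult_1 zero_less_mult_pos)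
  then show t: "t = 1" using p2 pt by (auto simp: power2_eq_1_iff)
  show "c = k" "c' = k'" using D A33 p t by simp_all
qed

lemma matrix_vector_mult_3_nth:
  fixes A :: "real^3^3"
  shows "(A *v x) $ i = A$i$1 * x$1 + A$i$2 * x$2 + A$i$3 * x$3"
  by (simp add: matrix_vector_mult_def sum_3)

text \<open>Restricting to rays \<open>x = \<tau> w\<close> and letting \<open>\<tau> \<rightarrow> 0\<close> extracts the homogeneous parts of the
  jets: division by \<open>\<tau>\<^sup>2\<close> gives the quadratic part; once this shows that the third row of \<open>A\<close> is
  \<open>(0, 0, \<plusminus>1)\<close>, division by \<open>\<tau>\<^sup>3\<close> gives the cubic part of the third coordinate.\<close>

lemma nf_map_jet_rigidity:
  fixes A :: "real^3^3" and t :: "real^2 \<Rightarrow> real^2"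
  assumes nf: "nf_data a b1 b2 b3 c1 c2 c3" and hnf: "nf_data ha hb1 hb2 hb3 hc1 hc2 hc3"
    and rot: "rotation_matrix A"
    and V: "open V" "0 \<in> V" "\<And>n. Ck_on n V t" and t0: "t 0 = 0"
    and der: "(t has_derivative L) (at 0)" and det: "det (matrix L) > 0"
    and jet: "jet_eq 3 (\<lambda>x. A *v nf_map a b1 b2 b3 c1 c2 c3 (t x)) (nf_map ha hb1 hb2 hb3 hc1 hc2 hc3) 0"
  shows "A = mat 1" "L = id" "a = ha" "b1 0 = hb1 0" "b3 0 = hb3 0" "c1 0 = hc1 0" "c3 0 = hc3 0"
proof -
  define f where "f = nf_map a b1 b2 b3 c1 c2 c3"
  define g where "g = nf_map ha hb1 hb2 hb3 hc1 hc2 hc3"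
  define h where "h x = A *v f (t x) - g x" for x
  obtain U where U: "open U" "0 \<in> U"
    "\<And>n. Ck_on n U (\<lambda>x. b1 (x$1))" "\<And>n. Ck_on n U b2" "\<And>n. Ck_on n U (\<lambda>x. b3 (x$2))"
    "\<And>n. Ck_on n U (\<lambda>x. c1 (x$1))" "\<And>n. Ck_on n U c2" "\<And>n. Ck_on n U (\<lambda>x. c3 (x$2))"
    using nf_dataE[OF nf] by blast
  obtain U' where U': "open U'" "0 \<in> U'"
    "\<And>n. Ck_on n U' (\<lambda>x. hb1 (x$1))" "\<And>n. Ck_on n U' hb2" "\<And>n. Ck_on n U' (\<lambda>x. hb3 (x$2))"
    "\<And>n. Ck_on n U' (\<lambda>x. hc1 (x$1))" "\<And>n. Ck_on n U' hc2" "\<And>n. Ck_on n U' (\<lambda>x. hc3 (x$2))"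
    using nf_dataE[OF hnf] by blast
  \<comment> \<open>A neighbourhood of 0 on which both sides of the jet equation are smooth.\<close>
  define W where "W = (V \<inter> t -` U) \<inter> U'"
  have "open (V \<inter> t -` U)"
    using continuous_open_preimage[OF Ck_on_imp_continuous[OF V(3)[of 0]] V(1) U(1)] .
  then have W: "open W" "0 \<in> W" "W \<subseteq> V" "t ` W \<subseteq> U" "W \<subseteq> U'"
    unfolding W_def using U' U V t0 by auto
  have "Ck_on n W (\<lambda>x. f (t x))" for n
    by (rule Ck_on_compose[OF W(4) nf_map_Ck_on[OF U(1,3-8), of n a, folded f_def] Ck_on_subset[OF V(3) W(3)]])
  then have Af: "Ck_on n W (\<lambda>x. A *v f (t x))" for n
    by (rule Ck_on_bounded_linear[OF matrix_vector_mul_bounded_linear])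
  have g: "Ck_on n W g" for n
    unfolding g_def by (rule Ck_on_subset[OF nf_map_Ck_on[OF U'(1,3-8)] W(5)])
  have "iter_pd is h 0 = 0" if "set is \<subseteq> Basis" "length is \<le> 3" for "is"
    using iter_pd_diff[OF W(1,2) Af g that(1)] jet that
    unfolding h_def[abs_def] f_def g_def jet_eq_def by simp
  then have small: "\<exists>d>0. \<forall>x. norm x < d \<longrightarrow> norm (h x) \<le> e * norm x ^ 3" if "e > 0" for e
    using jet_zero_imp_small[OF W(1,2), of 3 h e] Ck_on_diff[OF Af g] that
    unfolding h_def[abs_def] by blast
  have h3: "((\<lambda>\<tau>. h (\<tau> *\<^sub>R w) $ i / \<tau> ^ 3) \<longlongrightarrow> 0) (at_right 0)" for w i
    by (rule small_ray_tendsto[OF small])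
  have pos: "\<forall>\<^sub>F \<tau> in at_right 0. (0::real) < \<tau>" by (rule eventually_at_right_less)
  have id: "((\<lambda>\<tau>. \<tau>) \<longlongrightarrow> (0::real)) (at_right 0)" by (rule tendsto_ident_at)
  have h2: "((\<lambda>\<tau>. h (\<tau> *\<^sub>R w) $ i / \<tau> ^ 2) \<longlongrightarrow> 0) (at_right 0)" for w i
  proof -
    have "((\<lambda>\<tau>. \<tau> * (h (\<tau> *\<^sub>R w) $ i / \<tau> ^ 3)) \<longlongrightarrow> 0 * 0) (at_right 0)"
      by (intro tendsto_mult id h3)
    moreover have "\<forall>\<^sub>F \<tau> in at_right 0. \<tau> * (h (\<tau> *\<^sub>R w) $ i / \<tau> ^ 3) = h (\<tau> *\<^sub>R w) $ i / \<tau> ^ 2"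
      using pos by eventually_elim (simp add: field_simps power2_eq_square power3_eq_cube)
    ultimately show ?thesis using Lim_transform_eventually by fastforce
  qed
  \<comment> \<open>The direction varies with \<open>\<tau>\<close>, since \<open>t\<close> maps
    rays to curves; its limit is \<open>L w\<close>.\<close>
  define y where "y w \<tau> = (1 / \<tau>) *\<^sub>R t (\<tau> *\<^sub>R w)" for w \<tau>
  have y: "(y w \<longlongrightarrow> L w) (at_right 0)" for w
    unfolding y_def[abs_def] by (rule has_derivative_ray_tendsto[OF der t0])
  have ty: "t (\<tau> *\<^sub>R w) = \<tau> *\<^sub>R y w \<tau>" if "\<tau> > 0" for \<tau> w
    using that unfolding y_def by simp
  note fl = nf_map_scaled_tendsto[OF nf y, folded f_def]
  note gl = nf_map_scaled_tendsto[OF hnf tendsto_const, folded g_def]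
  have hrow: "h (\<tau> *\<^sub>R w) $ i = A$i$1 * f (\<tau> *\<^sub>R y w \<tau>) $ 1 + A$i$2 * f (\<tau> *\<^sub>R y w \<tau>) $ 2
      + A$i$3 * f (\<tau> *\<^sub>R y w \<tau>) $ 3 - g (\<tau> *\<^sub>R w) $ i" if "\<tau> > 0" for \<tau> w i
    unfolding h_def by (simp add: matrix_vector_mult_3_nth ty[OF that])
  \<comment> \<open>The third coordinate of \<open>f\<close> has no quadratic part, so the last
    column of \<open>A\<close> drops out in the limit.\<close>
  have quad: "A$i$1 * ((L w$1)^2 - (L w$2)^2) + A$i$2 * (a * ((L w$1)^2 + (L w$2)^2)) = G"
    if G: "((\<lambda>\<tau>. g (\<tau> *\<^sub>R w) $ i / \<tau>^2) \<longlongrightarrow> G) (at_right 0)" for i w G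
  proof -
    have "((\<lambda>\<tau>. A$i$1 * (f (\<tau> *\<^sub>R y w \<tau>) $ 1 / \<tau>^2) + A$i$2 * (f (\<tau> *\<^sub>R y w \<tau>) $ 2 / \<tau>^2)
        + A$i$3 * (f (\<tau> *\<^sub>R y w \<tau>) $ 3 / \<tau>^2) - g (\<tau> *\<^sub>R w) $ i / \<tau>^2)
      \<longlongrightarrow> A$i$1 * ((L w$1)^2 - (L w$2)^2) + A$i$2 * (a * ((L w$1)^2 + (L w$2)^2)) + A$i$3 * 0 - G)
      (at_right 0)"
      by (intro tendsto_add tendsto_diff tendsto_mult tendsto_const fl G)
    moreover have "\<forall>\<^sub>F \<tau> in at_right 0. A$i$1 * (f (\<tau> *\<^sub>R y w \<tau>) $ 1 / \<tau>^2) + A$i$2 * (f (\<tau> *\<^sub>R y w \<tau>) $ 2 / \<tau>^2)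
        + A$i$3 * (f (\<tau> *\<^sub>R y w \<tau>) $ 3 / \<tau>^2) - g (\<tau> *\<^sub>R w) $ i / \<tau>^2 = h (\<tau> *\<^sub>R w) $ i / \<tau>^2"
      using pos by eventually_elim (simp add: hrow add_divide_distrib diff_divide_distrib)
    ultimately have "((\<lambda>\<tau>. h (\<tau> *\<^sub>R w) $ i / \<tau>^2)
      \<longlongrightarrow> A$i$1 * ((L w$1)^2 - (L w$2)^2) + A$i$2 * (a * ((L w$1)^2 + (L w$2)^2)) + A$i$3 * 0 - G)
      (at_right 0)"
      by (rule Lim_transform_eventually)
    from tendsto_unique[OF _ this h2] show ?thesis by simp
  qed
  define M where "M = matrix L"
  have L: "linear L" using der has_derivative_linear by blast
  have Lw: "L w $ i = M$i$1 * w$1 + M$i$2 * w$2" for w i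
  proof -
    have "L w = M *v w" unfolding M_def using L by (simp add: matrix_works)
    then show ?thesis by (simp add: matrix_vector_mult_def sum_2)
  qed
  have d: "M$1$1 * M$2$2 - M$1$2 * M$2$1 > 0" using det unfolding M_def[symmetric] by (simp add: det_2)
  define D where "D = M$1$1 * M$2$2 - M$1$2 * M$2$1"
  have D: "D \<noteq> 0" using d unfolding D_def by simp
  have row3: "A$3$1 = 0" "A$3$2 = 0"
  proof -
    \<comment> \<open>The two vectors are the columns of the adjugate of \<open>M\<close>;
      \<open>L\<close> sends them to \<open>D\<close> times the coordinate vectors, so no inverse of
      \<open>L\<close> is required.\<close>
    have 1: "L (vector [M$2$2, - M$2$1]) $ 1 = D" "L (vector [M$2$2, - M$2$1]) $ 2 = 0"
      and 2: "L (vector [- M$1$2, M$1$1]) $ 1 = 0" "L (vector [- M$1$2, M$1$1]) $ 2 = D"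
      unfolding Lw D_def by simp_all
    have "D^2 * (A$3$1 + A$3$2 * a) = 0"
      using quad[OF gl(3), of "vector [M$2$2, - M$2$1]"] unfolding 1 by (simp add: algebra_simps)
    moreover have "D^2 * (- A$3$1 + A$3$2 * a) = 0"
      using quad[OF gl(3), of "vector [- M$1$2, M$1$1]"] unfolding 2 by (simp add: algebra_simps)
    ultimately have e: "A$3$1 + A$3$2 * a = 0" "- A$3$1 + A$3$2 * a = 0" using D by simp_all
    then show "A$3$1 = 0" by linarith
    then show "A$3$2 = 0" using e nf unfolding nf_data_def by simp
  qed
  have cubic: "A$3$3 * (c1 0 * (L w$1)^3 + c3 0 * (L w$2)^3) = hc1 0 * (w$1)^3 + hc3 0 * (w$2)^3" for w
  proof -
    have "((\<lambda>\<tau>. A$3$3 * (f (\<tau> *\<^sub>R y w \<tau>) $ 3 / \<tau>^3) - g (\<tau> *\<^sub>R w) $ 3 / \<tau>^3)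
      \<longlongrightarrow> A$3$3 * (c1 0 * (L w$1)^3 + c3 0 * (L w$2)^3) - (hc1 0 * (w$1)^3 + hc3 0 * (w$2)^3)) (at_right 0)"
      by (intro tendsto_diff tendsto_mult tendsto_const fl gl)
    moreover have "\<forall>\<^sub>F \<tau> in at_right 0. A$3$3 * (f (\<tau> *\<^sub>R y w \<tau>) $ 3 / \<tau>^3) - g (\<tau> *\<^sub>R w) $ 3 / \<tau>^3
        = h (\<tau> *\<^sub>R w) $ 3 / \<tau>^3"
      using pos by eventually_elim (simp add: hrow row3 diff_divide_distrib)
    ultimately have "((\<lambda>\<tau>. h (\<tau> *\<^sub>R w) $ 3 / \<tau>^3)
      \<longlongrightarrow> A$3$3 * (c1 0 * (L w$1)^3 + c3 0 * (L w$2)^3) - (hc1 0 * (w$1)^3 + hc3 0 * (w$2)^3)) (at_right 0)"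
      by (rule Lim_transform_eventually)
    from tendsto_unique[OF _ this h3] show ?thesis by simp
  qed
  have pos': "a > 0" "ha > 0" "c1 0 > 0" "c3 0 > 0" "hc1 0 > 0" "hc3 0 > 0"
    using nf hnf unfolding nf_data_def by auto
  have q1: "A$1$1 * ((M$1$1 * u + M$1$2 * v)\<^sup>2 - (M$2$1 * u + M$2$2 * v)\<^sup>2)
        + A$1$2 * (a * ((M$1$1 * u + M$1$2 * v)\<^sup>2 + (M$2$1 * u + M$2$2 * v)\<^sup>2)) = u\<^sup>2 - v\<^sup>2" for u v
    using quad[OF gl(1), of "vector [u, v]"] unfolding Lw by simp
  have q2: "A$2$1 * ((M$1$1 * u + M$1$2 * v)\<^sup>2 - (M$2$1 * u + M$2$2 * v)\<^sup>2)
        + A$2$2 * (a * ((M$1$1 * u + M$1$2 * v)\<^sup>2 + (M$2$1 * u + M$2$2 * v)\<^sup>2)) = ha * (u\<^sup>2 + v\<^sup>2)" for u v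
    using quad[OF gl(2), of "vector [u, v]"] unfolding Lw by simp
  have q3: "A$3$3 * (c1 0 * (M$1$1 * u + M$1$2 * v) ^ 3 + c3 0 * (M$2$1 * u + M$2$2 * v) ^ 3)
        = hc1 0 * u ^ 3 + hc3 0 * v ^ 3" for u v
    using cubic[of "vector [u, v]"] unfolding Lw by simp
  note R = normal_form_rigidity_algebra[OF rot d pos' q1 q2 row3 q3]
  show A: "A = mat 1" and a: "a = ha" and "c1 0 = hc1 0" "c3 0 = hc3 0" using R by auto
  show Lid: "L = id"
    by (rule ext) (simp add: vec_eq_iff forall_2 Lw R(2-5))
  \<comment> \<open>With linear part the identity, \<open>t\<close> differs from the identity by a
    quadratic error. This error still enters the cubic part of the second coordinate through the
    squares of the coordinates of \<open>t\<close>, so the coefficients of \<open>b\<close> need the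
    separate argument below.\<close>
  obtain K where K: "K \<ge> 0" "\<forall>\<^sub>F x in nhds 0. norm (t x - x) \<le> K * norm x ^ 2"
    using quadratic_remainder[OF V(1,2,3) t0 der] unfolding Lid id_apply by blast
  have h12: "h x $ 1 = (t x$1)^2 - (t x$2)^2 - ((x$1)^2 - (x$2)^2)"
    "h x $ 2 = a * ((t x$1)^2 + (t x$2)^2) + cub b1 b2 b3 (t x) - (a * ((x$1)^2 + (x$2)^2) + cub hb1 hb2 hb3 x)" for x
    unfolding h_def A f_def g_def a[symmetric] by (simp_all add: nf_map_nth)
  \<comment> \<open>Off the axis direction the coordinate of \<open>t\<close> is only the quadratic
    error, so its square has order four.\<close>
  have sq: "((\<lambda>\<tau>. (t (\<tau> *\<^sub>R w) $ i)^2 / \<tau>^3) \<longlongrightarrow> 0) (at_right 0)" if w: "w $ i = 0" "norm w = 1" for w i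
  proof (rule Lim_null_comparison)
    show "((\<lambda>\<tau>. K^2 * \<tau>) \<longlongrightarrow> 0) (at_right 0)"
      using tendsto_mult[OF tendsto_const id, of "K^2"] by simp
    have "((\<lambda>\<tau>. \<tau> *\<^sub>R w) \<longlongrightarrow> 0) (at_right 0)"
      using tendsto_scaleR[OF id tendsto_const, of w] by simp
    then have "\<forall>\<^sub>F \<tau> in at_right 0. norm (t (\<tau> *\<^sub>R w) - \<tau> *\<^sub>R w) \<le> K * norm (\<tau> *\<^sub>R w) ^ 2"
      using K(2) filterlim_iff by fast
    then show "\<forall>\<^sub>F \<tau> in at_right 0. norm ((t (\<tau> *\<^sub>R w) $ i)^2 / \<tau>^3) \<le> K^2 * \<tau>"
      using pos
    proof eventually_elim
      case (elim \<tau>)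
      have "\<bar>t (\<tau> *\<^sub>R w) $ i\<bar> = \<bar>(t (\<tau> *\<^sub>R w) - \<tau> *\<^sub>R w) $ i\<bar>" using w by simp
      also have "\<dots> \<le> norm (t (\<tau> *\<^sub>R w) - \<tau> *\<^sub>R w)" by (rule component_le_norm_cart)
      also have "\<dots> \<le> K * \<tau>^2" using elim w by simp
      finally have "\<bar>t (\<tau> *\<^sub>R w) $ i\<bar>^2 \<le> (K * \<tau>^2)^2" by (rule power_mono) simp
      also have "\<dots> = K^2 * \<tau> * \<tau>^3" by (simp add: power2_eq_square power3_eq_cube)
      finally show ?case using elim(2) by (simp add: divide_le_eq)
    qed
  qed
  have cubs: "((\<lambda>\<tau>. cub b1 b2 b3 (t (\<tau> *\<^sub>R w)) / \<tau>^3 - cub hb1 hb2 hb3 (\<tau> *\<^sub>R w) / \<tau>^3)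
      \<longlongrightarrow> (b1 0 * (w$1)^3 + b3 0 * (w$2)^3) - (hb1 0 * (w$1)^3 + hb3 0 * (w$2)^3)) (at_right 0)" for w
  proof -
    have "((\<lambda>\<tau>. cub b1 b2 b3 (\<tau> *\<^sub>R y w \<tau>) / \<tau>^3 - cub hb1 hb2 hb3 (\<tau> *\<^sub>R w) / \<tau>^3)
      \<longlongrightarrow> (b1 0 * (L w$1)^3 + b3 0 * (L w$2)^3) - (hb1 0 * (w$1)^3 + hb3 0 * (w$2)^3)) (at_right 0)"
      by (intro tendsto_diff cub_scaled_tendsto nf_data_isCont[OF nf] nf_data_isCont[OF hnf] y tendsto_const)
    moreover have "\<forall>\<^sub>F \<tau> in at_right 0. cub b1 b2 b3 (\<tau> *\<^sub>R y w \<tau>) / \<tau>^3 - cub hb1 hb2 hb3 (\<tau> *\<^sub>R w) / \<tau>^3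
        = cub b1 b2 b3 (t (\<tau> *\<^sub>R w)) / \<tau>^3 - cub hb1 hb2 hb3 (\<tau> *\<^sub>R w) / \<tau>^3"
      using pos by eventually_elim (simp add: ty)
    ultimately show ?thesis unfolding Lid id_apply by (rule Lim_transform_eventually)
  qed
  \<comment> \<open>On a coordinate axis, adding \<open>k = -a\<close> or \<open>k = a\<close> times
    the first coordinate to the second cancels the square of the coordinate along the axis, whose
    error would be cubic. What remains is the harmless off-axis square and the difference of the
    cubic terms.\<close>
  have lim: "b1 0 * (w$1)^3 + b3 0 * (w$2)^3 = hb1 0 * (w$1)^3 + hb3 0 * (w$2)^3"
    if w: "w $ i = 0" "norm w = 1"
      and hh: "\<And>\<tau>. h (\<tau> *\<^sub>R w) $ 2 + k * h (\<tau> *\<^sub>R w) $ 1 = 2 * a * (t (\<tau> *\<^sub>R w) $ i)^2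
        + (cub b1 b2 b3 (t (\<tau> *\<^sub>R w)) - cub hb1 hb2 hb3 (\<tau> *\<^sub>R w))" for w i k
  proof -
    have "((\<lambda>\<tau>. 2 * a * ((t (\<tau> *\<^sub>R w) $ i)^2 / \<tau>^3)
        + (cub b1 b2 b3 (t (\<tau> *\<^sub>R w)) / \<tau>^3 - cub hb1 hb2 hb3 (\<tau> *\<^sub>R w) / \<tau>^3))
      \<longlongrightarrow> 2 * a * 0 + ((b1 0 * (w$1)^3 + b3 0 * (w$2)^3) - (hb1 0 * (w$1)^3 + hb3 0 * (w$2)^3))) (at_right 0)"
      by (intro tendsto_add tendsto_mult tendsto_const sq w cubs)
    moreover have "2 * a * ((t (\<tau> *\<^sub>R w) $ i)^2 / \<tau>^3)
        + (cub b1 b2 b3 (t (\<tau> *\<^sub>R w)) / \<tau>^3 - cub hb1 hb2 hb3 (\<tau> *\<^sub>R w) / \<tau>^3)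
      = h (\<tau> *\<^sub>R w) $ 2 / \<tau>^3 + k * (h (\<tau> *\<^sub>R w) $ 1 / \<tau>^3)" for \<tau>
    proof -
      have "h (\<tau> *\<^sub>R w) $ 2 / \<tau>^3 + k * (h (\<tau> *\<^sub>R w) $ 1 / \<tau>^3)
        = (h (\<tau> *\<^sub>R w) $ 2 + k * h (\<tau> *\<^sub>R w) $ 1) / \<tau>^3"
        by (simp add: add_divide_distrib)
      then show ?thesis unfolding hh by (simp add: add_divide_distrib diff_divide_distrib)
    qed
    ultimately have 1: "((\<lambda>\<tau>. h (\<tau> *\<^sub>R w) $ 2 / \<tau>^3 + k * (h (\<tau> *\<^sub>R w) $ 1 / \<tau>^3))
      \<longlongrightarrow> 2 * a * 0 + ((b1 0 * (w$1)^3 + b3 0 * (w$2)^3) - (hb1 0 * (w$1)^3 + hb3 0 * (w$2)^3))) (at_right 0)"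
      by (simp only:)
    have 2: "((\<lambda>\<tau>. h (\<tau> *\<^sub>R w) $ 2 / \<tau>^3 + k * (h (\<tau> *\<^sub>R w) $ 1 / \<tau>^3)) \<longlongrightarrow> 0 + k * 0) (at_right 0)"
      by (intro tendsto_add tendsto_mult tendsto_const h3)
    show ?thesis using tendsto_unique[OF _ 1 2] by simp
  qed
  have ax: "norm (axis j (1::real) :: real^2) = 1" for j by simp
  show "b1 0 = hb1 0"
    using lim[of "axis 1 1" 2 "- a"] ax unfolding h12 by (simp add: axis_def algebra_simps)
  show "b3 0 = hb3 0"
    using lim[of "axis 2 1" 1 a] ax unfolding h12 by (simp add: axis_def algebra_simps)
qed

section \<open>Symmetries of a germ\<close>

text \<open>The point \<open>x0\<close> need only lie in the closure of \<open>K\<close>: all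
  iterated partial derivatives agree on the open set \<open>K\<close>, and continuity carries the
  equality to the limit point.\<close>

lemma jet_eq_if_eq_on_open:
  fixes f g :: "'a::euclidean_space \<Rightarrow> 'b::real_normed_vector"
  assumes U: "open U" "x0 \<in> U" "\<And>n. Ck_on n U f" "\<And>n. Ck_on n U g"
    and K: "open K" "x0 \<in> closure K" "\<And>x. x \<in> K \<Longrightarrow> f x = g x"
  shows "jet_eq r f g x0"
  unfolding jet_eq_def
proof (intro allI impI)
  fix "is" :: "'a list" assume "set is \<subseteq> Basis \<and> length is \<le> r"
  then have "is": "set is \<subseteq> Basis" by simp
  obtain x where x: "\<And>n. x n \<in> K" "x \<longlonglongrightarrow> x0"
    using K(2) unfolding closure_sequential by blast
  have "isCont (iter_pd is f) x0" "isCont (iter_pd is g) x0"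
    using continuous_on_iter_pd[OF U(1,3) "is"] continuous_on_iter_pd[OF U(1,4) "is"] U(1,2)
    by (simp_all add: continuous_on_eq_continuous_at)
  then have "(\<lambda>n. iter_pd is f (x n)) \<longlonglongrightarrow> iter_pd is f x0"
    and g: "(\<lambda>n. iter_pd is g (x n)) \<longlonglongrightarrow> iter_pd is g x0"
    using x(2) isCont_tendsto_compose by blast+
  moreover have "(\<lambda>n. iter_pd is f (x n)) = (\<lambda>n. iter_pd is g (x n))"
    by (rule ext) (rule iter_pd_cong[OF K(1) x(1)], rule K(3))
  ultimately show "iter_pd is f x0 = iter_pd is g x0"
    using LIMSEQ_unique by metis
qed

text \<open>On the cone both \<open>x$1\<close> and \<open>x$2\<close> are comparable to \<open>norm x\<close>, so dividing
  \<open>2 a (U\<^sup>2 - u\<^sup>2) = b(u, v) - b(U, V)\<close> by \<open>U + u\<close>, and likewise for the other coordinate, shows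
  that \<open>s x - x\<close> is at most half its own size.\<close>

lemma nf_map_symmetry_id_on_cone:
  fixes s :: "real^2 \<Rightarrow> real^2"
  assumes nf: "nf_data a b1 b2 b3 c1 c2 c3"
    and s: "s 0 = 0" "(s has_derivative id) (at 0)"
    and inv: "\<forall>\<^sub>F x in nhds 0. nf_map a b1 b2 b3 c1 c2 c3 (s x) = nf_map a b1 b2 b3 c1 c2 c3 x"
  shows "\<exists>d>0. \<forall>x. norm x < d \<longrightarrow> norm x < 2 * x$1 \<longrightarrow> norm x < 2 * x$2 \<longrightarrow> s x = x"
proof -
  have a: "a > 0" using nf unfolding nf_data_def by blast
  define b where "b = cub b1 b2 b3"
  obtain U where U: "open U" "0 \<in> U"
    "\<And>n. Ck_on n U (\<lambda>x. b1 (x$1))" "\<And>n. Ck_on n U b2" "\<And>n. Ck_on n U (\<lambda>x. b3 (x$2))"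
    using nf_dataE[OF nf] by metis
  have "vanishes_to_order (0 + 3) U b"
    unfolding b_def using U by (intro cub_vanishes) auto
  then have "vanishes_to_order (Suc (Suc (Suc 0))) U b" by (simp only: numeral_3_eq_3 add_0_left)
  then obtain b' where b': "\<And>x. x \<in> U \<Longrightarrow> (b has_derivative b' x) (at x)"
    "\<And>i. i \<in> Basis \<Longrightarrow> vanishes_to_order (Suc (Suc 0)) U (\<lambda>x. b' x i)"
    using vanishes_to_orderE by blast
  \<comment> \<open>On the ball of radius \<open>2 * r\<close> this bounds the partial derivatives
    of \<open>b\<close> by \<open>a / 8 * r\<close>. The dimension 2 doubles it to the Lipschitz
    constant \<open>a / 4 * r\<close>, which yields the contraction factor \<open>1 / 4\<close> per
    coordinate.\<close>
  have "\<forall>\<^sub>F x in nhds 0. norm (b' x i) \<le> a / 16 * norm x" if "i \<in> Basis" for i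
    using vanishes_imp_small[OF U(1,2) b'(2)[OF that], of "a / 16"] a
    unfolding eventually_nhds_metric by simp
  then have "\<forall>\<^sub>F x in nhds 0. \<forall>i\<in>Basis. norm (b' x i) \<le> a / 16 * norm x"
    by (simp add: eventually_ball_finite)
  moreover have "\<forall>\<^sub>F x in nhds 0. x \<in> U"
    using U eventually_nhds_in_open by blast
  ultimately have "\<forall>\<^sub>F x in nhds 0. x \<in> U \<and> (\<forall>i\<in>Basis. norm (b' x i) \<le> a / 16 * norm x)"
    by eventually_elim simp
  then obtain d1 where d1: "d1 > 0" "\<And>x. norm x < d1 \<Longrightarrow> x \<in> U"
    "\<And>x i. norm x < d1 \<Longrightarrow> i \<in> Basis \<Longrightarrow> norm (b' x i) \<le> a / 16 * norm x"
    unfolding eventually_nhds_metric by auto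
  obtain d2 where d2: "d2 > 0" "\<And>x. norm x < d2 \<Longrightarrow> norm (s x - x) \<le> 1 / 4 * norm x"
    using s(2)[unfolded has_derivative_at_alt, THEN conjunct2, rule_format, of "1 / 4"] s(1) by auto
  obtain d3 where d3: "d3 > 0"
    "\<And>x. norm x < d3 \<Longrightarrow> nf_map a b1 b2 b3 c1 c2 c3 (s x) = nf_map a b1 b2 b3 c1 c2 c3 x"
    using inv unfolding eventually_nhds_metric by auto
  \<comment> \<open>Half of \<open>d1\<close> is taken because the estimate on \<open>b\<close> is
    used on a ball of twice the radius, which contains both \<open>x\<close> and
    \<open>s x\<close>.\<close>
  define d where "d = min (d1 / 2) (min d2 d3)"
  have "s x = x" if x: "norm x < d" "norm x < 2 * x$1" "norm x < 2 * x$2" for x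
  proof -
    define r where "r = norm x"
    have r: "r > 0" using x(2) unfolding r_def by (cases "x = 0") auto
    have sx: "norm (s x - x) \<le> r / 4" using d2(2) x(1) unfolding d_def r_def by simp
    then have nsx: "norm (s x) \<le> 2 * r"
      using norm_triangle_ineq[of "s x - x" x] r unfolding r_def[symmetric] by simp
    have "norm (b (s x) - b x) \<le> real DIM(real^2) * (a / 8 * r) * norm (s x - x)"
    proof (rule norm_diff_le_partials[of "cball 0 (2 * r)" _ _ b b'])
      show "x \<in> cball 0 (2 * r)" "s x \<in> cball 0 (2 * r)" using nsx r unfolding r_def by auto
      fix z :: "real^2" assume "z \<in> cball 0 (2 * r)"
      then have z: "norm z \<le> 2 * r" by simp
      then have z1: "norm z < d1" using x(1) unfolding d_def r_def by simp
      then show "(b has_derivative b' z) (at z)" using b'(1) d1(2) by blast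
      fix i :: "real^2" assume "i \<in> Basis"
      then have "norm (b' z i) \<le> a / 16 * norm z" using d1(3) z1 by blast
      also have "\<dots> \<le> a / 16 * (2 * r)" using z a by (intro mult_left_mono) auto
      finally show "norm (b' z i) \<le> a / 8 * r" by simp
    qed simp
    then have bb: "\<bar>b (s x) - b x\<bar> \<le> a / 4 * r * norm (s x - x)" by simp
    have eq: "nf_map a b1 b2 b3 c1 c2 c3 (s x) = nf_map a b1 b2 b3 c1 c2 c3 x"
      using d3(2) x(1) unfolding d_def by simp
    have e1: "(s x$1)^2 - (s x$2)^2 = (x$1)^2 - (x$2)^2"
      using arg_cong[OF eq, of "\<lambda>z. z $ 1"] unfolding nf_map_nth .
    have e2: "a * ((s x$1)^2 + (s x$2)^2) + b (s x) = a * ((x$1)^2 + (x$2)^2) + b x"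
      using arg_cong[OF eq, of "\<lambda>z. z $ 2"] unfolding nf_map_nth b_def .
    have coord: "\<bar>s x $ i - x $ i\<bar> \<le> norm (s x - x) / 4"
      if sq: "2 * a * ((s x $ i)^2 - (x $ i)^2) = b x - b (s x)" and xi: "r < 2 * x $ i" for i
    proof -
      have "\<bar>s x $ i - x $ i\<bar> \<le> r / 4"
        using component_le_norm_cart[of "s x - x" i] sx by simp
      \<comment> \<open>In the cone \<open>2 * x $ i\<close> exceeds \<open>r\<close>, and passing
        from \<open>x $ i\<close> to \<open>s x $ i\<close> loses at most
        \<open>r / 4\<close>.\<close>
      then have "r / 2 \<le> s x $ i + x $ i" using xi r by linarith
      then have "a * r * \<bar>s x $ i - x $ i\<bar> \<le> 2 * a * (s x $ i + x $ i) * \<bar>s x $ i - x $ i\<bar>"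
        using a by (intro mult_right_mono) auto
      also have "\<dots> = \<bar>2 * a * ((s x $ i)^2 - (x $ i)^2)\<bar>"
      proof -
        have "2 * a * ((s x $ i)^2 - (x $ i)^2) = 2 * a * (s x $ i + x $ i) * (s x $ i - x $ i)"
          by (simp add: power2_eq_square algebra_simps)
        then show ?thesis using \<open>r / 2 \<le> s x $ i + x $ i\<close> r a by (simp add: abs_mult)
      qed
      also have "\<dots> \<le> a * r * (norm (s x - x) / 4)" using bb unfolding sq by (simp add: abs_minus_commute)
      finally show ?thesis using a r by simp
    qed
    have "\<bar>s x $ 1 - x $ 1\<bar> \<le> norm (s x - x) / 4"
    proof (rule coord)
      \<comment> \<open>Adding \<open>a\<close> times \<open>e1\<close> to \<open>e2\<close>
        isolates the first square; subtracting it isolates the second.\<close>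
      show "2 * a * ((s x $ 1)^2 - (x $ 1)^2) = b x - b (s x)" using e1 e2 by algebra
      show "r < 2 * x $ 1" using x(2) unfolding r_def .
    qed
    moreover have "\<bar>s x $ 2 - x $ 2\<bar> \<le> norm (s x - x) / 4"
    proof (rule coord)
      show "2 * a * ((s x $ 2)^2 - (x $ 2)^2) = b x - b (s x)" using e1 e2 by algebra
      show "r < 2 * x $ 2" using x(3) unfolding r_def .
    qed
    moreover have "norm (s x - x) \<le> \<bar>s x $ 1 - x $ 1\<bar> + \<bar>s x $ 2 - x $ 2\<bar>"
      using norm_le_l1_cart[of "s x - x"] by (simp add: sum_2)
    ultimately have "norm (s x - x) \<le> 0" using norm_ge_zero[of "s x - x"] by linarith
    then show ?thesis by simp
  qed
  moreover have "d > 0" unfolding d_def using d1(1) d2(1) d3(1) by simp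
  ultimately show ?thesis by blast
qed

lemma nf_map_symmetry_jet_id:
  fixes s :: "real^2 \<Rightarrow> real^2"
  assumes nf: "nf_data a b1 b2 b3 c1 c2 c3"
    and U: "open U" "0 \<in> U" "\<And>n. Ck_on n U s"
    and s: "s 0 = 0" "(s has_derivative id) (at 0)"
    and inv: "\<forall>\<^sub>F x in nhds 0. nf_map a b1 b2 b3 c1 c2 c3 (s x) = nf_map a b1 b2 b3 c1 c2 c3 x"
  shows "jet_eq r s id 0"
proof -
  obtain d where d: "d > 0"
    "\<And>x. norm x < d \<Longrightarrow> norm x < 2 * x$1 \<Longrightarrow> norm x < 2 * x$2 \<Longrightarrow> s x = x"
    using nf_map_symmetry_id_on_cone[OF nf s inv] by blast
  define K where "K = {x::real^2. norm x < d \<and> norm x < 2 * x$1 \<and> norm x < 2 * x$2}"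
  show ?thesis
  proof (rule jet_eq_if_eq_on_open[OF U])
    show "Ck_on n U id" for n
      unfolding id_def by (rule Ck_on_linear[OF bounded_linear_ident])
    show "open K"
      unfolding K_def by (intro open_Collect_conj open_Collect_less continuous_intros)
    show "s x = id x" if "x \<in> K" for x
      using d(2) that unfolding K_def by simp
    show "0 \<in> closure K"
      unfolding closure_approachable
    proof (intro allI impI)
      fix e :: real assume "e > 0"
      define \<tau> where "\<tau> = min d e / 2"
      have \<tau>: "\<tau> > 0" "2 * \<tau> \<le> d" "2 * \<tau> \<le> e" using \<open>e > 0\<close> d(1) unfolding \<tau>_def by auto
      \<comment> \<open>Points of the diagonal lie in the cone, because their norm is
        \<open>sqrt 2 * \<tau>\<close>, less than twice each coordinate.\<close>
      define x :: "real^2" where "x = vector [\<tau>, \<tau>]"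
      have "(norm x)^2 = 2 * \<tau>^2"
        unfolding power2_norm_eq_inner x_def by (simp add: inner_vec_def sum_2 power2_eq_square)
      also have "\<dots> < (2 * \<tau>)^2" using \<tau>(1) by (simp add: power_mult_distrib)
      finally have n: "norm x < 2 * \<tau>" by (rule power2_less_imp_less) (use \<tau> in simp)
      then have "x \<in> K" using \<tau> unfolding K_def x_def by simp
      moreover have "dist x 0 < e" using n \<tau> by simp
      ultimately show "\<exists>y\<in>K. dist y 0 < e" by blast
    qed
  qed
qed

section \<open>Passage between \<open>s\<close> and its inverse germ, and the two
  conclusions\<close>

theorem theorem2:
  fixes a ha :: real
    and b1 b3 c1 c3 hb1 hb3 hc1 hc3 :: "real \<Rightarrow> real"
    and b2 c2 hb2 hc2 :: "real^2 \<Rightarrow> real"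
    and s sinv :: "real^2 \<Rightarrow> real^2"
    and A :: "real^3^3"
  assumes "nf_data a b1 b2 b3 c1 c2 c3"
    and "nf_data ha hb1 hb2 hb3 hc1 hc2 hc3"
    and "or_diffeo_germ s sinv"
    and "rotation_matrix A"
  shows
    "(jet_eq 3 (\<lambda>x. A *v nf_map a b1 b2 b3 c1 c2 c3 (sinv x)) (nf_map ha hb1 hb2 hb3 hc1 hc2 hc3) 0
       \<longrightarrow> a = ha \<and> b1 0 = hb1 0 \<and> b3 0 = hb3 0 \<and> c1 0 = hc1 0 \<and> c3 0 = hc3 0
           \<and> jet_eq 3 (nf_map a b1 b2 b3 c1 c2 c3) (nf_map ha hb1 hb2 hb3 hc1 hc2 hc3) 0)
     \<and> ((\<exists>e>0. \<forall>x. norm x < e \<longrightarrow>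
            A *v nf_map a b1 b2 b3 c1 c2 c3 (sinv x) = nf_map a b1 b2 b3 c1 c2 c3 x)
        \<longrightarrow> A = mat 1 \<and> (\<forall>r\<ge>1. jet_eq r s id 0))"
proof -
  obtain U V where UV: "open U" "open V" "0 \<in> U" "s 0 = 0" "s ` U = V" "smooth_on U s" "smooth_on V sinv"
    "\<And>x. x \<in> U \<Longrightarrow> sinv (s x) = x" "det (jacobian s (at 0)) > 0"
    using assms(3) unfolding or_diffeo_germ_def by blast
  have V0: "0 \<in> V" and t0: "sinv 0 = 0" using UV(3,4,5,8) by (force, metis)
  have s: "Ck_on n U s" and t: "Ck_on n V sinv" for n
    using smooth_on_imp_Ck_on UV(6,7) by blast+
  define S where "S = frechet_derivative s (at 0)"
  define L where "L = frechet_derivative sinv (at 0)"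
  have S: "(s has_derivative S) (at 0)"
    unfolding S_def using Ck_on_frechet_derivative(1)[OF UV(1) s UV(3)] .
  have L: "(sinv has_derivative L) (at 0)"
    unfolding L_def using Ck_on_frechet_derivative(1)[OF UV(2) t V0] .
  have "((\<lambda>x. sinv (s x)) has_derivative (\<lambda>x. L (S x))) (at 0)"
    by (rule has_derivative_compose[OF S]) (simp add: UV(4) L)
  then have "((\<lambda>x. x) has_derivative (\<lambda>x. L (S x))) (at 0)"
    by (rule has_derivative_transform_within_open[OF _ UV(1,3)]) (rule UV(8))
  then have LS: "(\<lambda>x. L (S x)) = (\<lambda>x. x)"
    using has_derivative_unique has_derivative_ident by blast
  \<comment> \<open>The orientation hypothesis concerns \<open>s\<close>, whereas the rigidity
    result needs the determinant of the linear part of \<open>sinv\<close>. Their product is 1, so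
    the sign carries over.\<close>
  have "matrix L ** matrix S = matrix (L \<circ> S)"
    by (rule matrix_compose[symmetric]) (use S L has_derivative_linear in blast)+
  also have "\<dots> = mat 1"
    using LS by (simp add: o_def matrix_id_mat_1[unfolded id_def])
  finally have "det (matrix L) * det (matrix S) = 1"
    by (metis det_I det_mul)
  moreover have "det (matrix S) > 0" using UV(9) unfolding jacobian_def S_def .
  ultimately have detL: "det (matrix L) > 0"
    by (metis zero_less_mult_pos2 zero_less_one)
  note rigid = nf_map_jet_rigidity[OF assms(1) _ assms(4) UV(2) V0 t t0 L detL]
  show ?thesis
  proof (intro conjI impI)
    assume jet: "jet_eq 3 (\<lambda>x. A *v nf_map a b1 b2 b3 c1 c2 c3 (sinv x)) (nf_map ha hb1 hb2 hb3 hc1 hc2 hc3) 0"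
    note R = rigid[OF assms(2) jet]
    show "a = ha" "b1 0 = hb1 0" "b3 0 = hb3 0" "c1 0 = hc1 0" "c3 0 = hc3 0" by (fact R)+
    show "jet_eq 3 (nf_map a b1 b2 b3 c1 c2 c3) (nf_map ha hb1 hb2 hb3 hc1 hc2 hc3) 0"
      using nf_map_jet_eqI[OF assms(1)] assms(2) R(3-7) by blast
  next
    assume "\<exists>e>0. \<forall>x. norm x < e \<longrightarrow>
      A *v nf_map a b1 b2 b3 c1 c2 c3 (sinv x) = nf_map a b1 b2 b3 c1 c2 c3 x"
    then obtain e where e: "e > 0" "\<And>x. norm x < e \<Longrightarrow>
      A *v nf_map a b1 b2 b3 c1 c2 c3 (sinv x) = nf_map a b1 b2 b3 c1 c2 c3 x" by blast
    \<comment> \<open>Equal germs have equal jets, so the rigidity result applies with the second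
      normal form equal to the first.\<close>
    have "jet_eq 3 (\<lambda>x. A *v nf_map a b1 b2 b3 c1 c2 c3 (sinv x)) (nf_map a b1 b2 b3 c1 c2 c3) 0"
      unfolding jet_eq_def using e by (intro allI impI iter_pd_cong[of "ball 0 e"]) auto
    note R = rigid[OF assms(1) this]
    show A: "A = mat 1" by (fact R)
    have Sid: "S = id" using LS R(2) by (auto simp: fun_eq_iff)
    have "isCont s 0" using S has_derivative_continuous by blast
    then have "(s \<longlongrightarrow> 0) (nhds 0)"
      using UV(4) tendsto_at_iff_tendsto_nhds[of s 0] by (simp add: isCont_def)
    \<comment> \<open>For \<open>x\<close> near 0 the point \<open>s x\<close> lies in the ball
      where the symmetry holds. Evaluating it there, with \<open>A\<close> the identity, turns a
      statement about \<open>sinv\<close> into invariance of the map under \<open>s\<close>.\<close>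
    then have "\<forall>\<^sub>F x in nhds 0. norm (s x) < e"
      using order_tendstoD(2)[OF tendsto_norm] e(1) by fastforce
    moreover have "\<forall>\<^sub>F x in nhds 0. x \<in> U"
      using UV(1,3) eventually_nhds_in_open by blast
    ultimately have inv: "\<forall>\<^sub>F x in nhds 0. nf_map a b1 b2 b3 c1 c2 c3 (s x) = nf_map a b1 b2 b3 c1 c2 c3 x"
    proof eventually_elim
      case (elim x)
      then show ?case using e(2)[of "s x"] UV(8)[of x] A by simp
    qed
    show "\<forall>r\<ge>1. jet_eq r s id 0"
      using nf_map_symmetry_jet_id[OF assms(1) UV(1,3) s UV(4) S[unfolded Sid] inv] by blast
  qed
qed

end
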